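(* Let $(H,\mathcal{R},\chi)$ be a pre-Cartier quasitriangular Hopf algebra with antipode $S$, and suppose $\chi=b^1(a)$ for some $a\in H$, where $b^1(a)=1\otimes a-\Delta(a)+a\otimes 1$. Then $(H,\mathcal{R},\chi)$ is Cartier if and only if $a-S(a)$ is a primitive element of $H$.
   Context: Everything is over a field $\Bbbk$. For $T=\sum_i T^i\otimes T_i\in H\otimes H$ write $T_{12}=T\otimes 1$, $T_{23}=1\otimes T$, $T_{13}=\sum_i T^i\otimes 1\otimes T_i$, $T^{\mathrm{op}}=\sum_i T_i\otimes T^i$; $\Delta^{\mathrm{op}}$ is $\Delta$ followed by the flip. A quasitriangular Hopf algebra $(H,\mathcal{R})$ is a Hopf algebra $H$ with an invertible $\mathcal{R}\in H\otimes H$ such that $\Delta^{\mathrm{op}}(h)=\mathcal{R}\Delta(h)\mathcal{R}^{-1}$ for all $h\in H$, $(\mathrm{Id}\otimes\Delta)(\mathcal{R})=\mathcal{R}_{13}\mathcal{R}_{12}$, $(\Delta\otimes\mathrm{Id})(\mathcal{R})=\mathcal{R}_{13}\mathcal{R}_{23}$. An infinitesimal $\mathcal{R}$-matrix for $(H,\mathcal{R})$ is $\chi\in H\otimes H$ such that $\chi\Delta(h)=\Delta(h)\chi$ for all $h$, $(\mathrm{Id}\otimes\Delta)(\chi)=\chi_{12}+\mathcal{R}_{12}^{-1}\chi_{13}\mathcal{R}_{12}$, and $(\Delta\otimes\mathrm{Id})(\chi)=\chi_{23}+\mathcal{R}_{23}^{-1}\chi_{13}\mathcal{R}_{23}$;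 then $(H,\mathcal{R},\chi)$ is called pre-Cartier. It is called Cartier if in addition $\mathcal{R}\chi=\chi^{\mathrm{op}}\mathcal{R}$. An element $p\in H$ is primitive if $\Delta(p)=p\otimes 1+1\otimes p$. *)

theory Defs
  imports Complex_Main "HOL-Library.Poly_Mapping"
begin

subsection \<open>Free vector spaces\<close>

text \<open>
  The type \<open>'x \<Rightarrow>\<^sub>0 'k\<close> is the free vector space over the field \<open>'k\<close> on the set of all
  elements of \<open>'x\<close>, with basis \<open>Poly_Mapping.single x 1\<close>.  The multiplication that the library
  puts on this type when \<open>'x\<close> is an additive monoid is not used.
\<close>

abbreviation fbasis :: "'x \<Rightarrow> ('x \<Rightarrow>\<^sub>0 'k::field)" where
  "fbasis x \<equiv> Poly_Mapping.single x 1"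

definition fscale :: "'k::field \<Rightarrow> ('x \<Rightarrow>\<^sub>0 'k) \<Rightarrow> ('x \<Rightarrow>\<^sub>0 'k)" where
  "fscale c t = Poly_Mapping.map ((*) c) t"

lemma lookup_fscale [simp]:
  "Poly_Mapping.lookup (fscale c t) x = c * Poly_Mapping.lookup t x"
  by (simp add: fscale_def Poly_Mapping.map.rep_eq when_def)

interpretation free: vector_space "fscale :: 'k::field \<Rightarrow> ('x \<Rightarrow>\<^sub>0 'k) \<Rightarrow> ('x \<Rightarrow>\<^sub>0 'k)"
  by unfold_locales (rule poly_mapping_eqI; simp add: lookup_add algebra_simps)+

text \<open>Linear extension of a map given on the basis.\<close>

definition lin_ext :: "('k::field \<Rightarrow> 'v \<Rightarrow> 'v) \<Rightarrow> ('x \<Rightarrow> 'v) \<Rightarrow> ('x \<Rightarrow>\<^sub>0 'k) \<Rightarrow> 'v::ab_group_add" where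
  "lin_ext scale f t = (\<Sum>x\<in>Poly_Mapping.keys t. scale (Poly_Mapping.lookup t x) (f x))"

abbreviation fext :: "('x \<Rightarrow> ('y \<Rightarrow>\<^sub>0 'k::field)) \<Rightarrow> ('x \<Rightarrow>\<^sub>0 'k) \<Rightarrow> ('y \<Rightarrow>\<^sub>0 'k)" where
  "fext \<equiv> lin_ext fscale"

text \<open>Bilinear extension of a binary operation on the basis.\<close>

definition fmult :: "('x \<Rightarrow> 'x \<Rightarrow> 'x) \<Rightarrow> ('x \<Rightarrow>\<^sub>0 'k::field) \<Rightarrow> ('x \<Rightarrow>\<^sub>0 'k) \<Rightarrow> ('x \<Rightarrow>\<^sub>0 'k)" where
  "fmult opr t u = fext (\<lambda>p. fext (\<lambda>q. fbasis (opr p q)) u) t"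

text \<open>A choice of representative of a coset.\<close>

definition rep :: "'x set \<Rightarrow> 'x" where
  "rep A = (SOME t. t \<in> A)"

context vector_space
begin

lemma lin_ext_superset:
  assumes "finite X" "Poly_Mapping.keys t \<subseteq> X"
  shows "lin_ext scale f t = (\<Sum>x\<in>X. scale (Poly_Mapping.lookup t x) (f x))"
  unfolding lin_ext_def
  by (rule sum.mono_neutral_left) (use assms in \<open>auto simp: in_keys_iff\<close>)

lemma lin_ext_add: "lin_ext scale f (t + u) = lin_ext scale f t + lin_ext scale f u"
proof -
  let ?X = "Poly_Mapping.keys t \<union> Poly_Mapping.keys u"
  have "lin_ext scale f (t + u) = (\<Sum>x\<in>?X. scale (Poly_Mapping.lookup (t + u) x) (f x))"
    by (rule lin_ext_superset) (simp_all add: Poly_Mapping.keys_add)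
  moreover have "lin_ext scale f t = (\<Sum>x\<in>?X. scale (Poly_Mapping.lookup t x) (f x))"
    by (rule lin_ext_superset) simp_all
  moreover have "lin_ext scale f u = (\<Sum>x\<in>?X. scale (Poly_Mapping.lookup u x) (f x))"
    by (rule lin_ext_superset) simp_all
  ultimately show ?thesis
    by (simp add: lookup_add scale_left_distrib sum.distrib)
qed

lemma lin_ext_fscale: "lin_ext scale f (fscale c t) = scale c (lin_ext scale f t)"
proof -
  have "Poly_Mapping.keys (fscale c t) \<subseteq> Poly_Mapping.keys t"
    by (auto simp: in_keys_iff)
  hence "lin_ext scale f (fscale c t) =
      (\<Sum>x\<in>Poly_Mapping.keys t. scale (Poly_Mapping.lookup (fscale c t) x) (f x))"
    by (intro lin_ext_superset) simp_all
  thus ?thesis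
    by (simp add: lin_ext_def scale_sum_right)
qed

lemma lin_ext_diff: "lin_ext scale f (t - u) = lin_ext scale f t - lin_ext scale f u"
  using lin_ext_add[of f "t - u" u] by (simp add: algebra_simps)

lemma lin_ext_fbasis [simp]: "lin_ext scale f (fbasis x) = f x"
  by (simp add: lin_ext_def)

lemma lin_ext_span:
  assumes "\<And>r. r \<in> X \<Longrightarrow> lin_ext scale f r \<in> N" "subspace N" "t \<in> free.span X"
  shows "lin_ext scale f t \<in> N"
proof -
  have 0: "lin_ext scale f 0 = 0" by (simp add: lin_ext_def)
  show ?thesis
    by (rule free.span_induct[where S=X and P="\<lambda>t. lin_ext scale f t \<in> N"])
      (use assms 0 in \<open>auto simp: free.subspace_def subspace_def lin_ext_add lin_ext_fscale\<close>)
qed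

lemma lin_ext_mem:
  assumes "\<And>x. f x \<in> N" "subspace N"
  shows "lin_ext scale f t \<in> N"
  unfolding lin_ext_def using assms by (intro subspace_sum subspace_scale)

lemma lin_ext_fun_diff: "lin_ext scale f t - lin_ext scale g t = lin_ext scale (\<lambda>x. f x - g x) t"
  by (simp add: lin_ext_def sum_subtractf scale_right_diff_distrib)

lemma lin_ext_fun_add: "lin_ext scale f t + lin_ext scale g t = lin_ext scale (\<lambda>x. f x + g x) t"
  by (simp add: lin_ext_def sum.distrib scale_right_distrib)

lemma lin_ext_fun_scale: "scale c (lin_ext scale f t) = lin_ext scale (\<lambda>x. scale c (f x)) t"
  by (simp add: lin_ext_def scale_sum_right mult.commute)

end


subsection \<open>Tensor powers of an algebra\<close>

text \<open>
  The vector spaces \<open>H \<otimes> H\<close> and \<open>H \<otimes> H \<otimes> H\<close> are constructed as the free vector spaces on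
  pairs and on triples of elements of \<open>H\<close>, modulo the subspaces spanned by the multilinearity
  relations.  Their elements are the cosets of these subspaces, so the types below also contain
  sets that are not tensors; \<open>T2\<close> is the actual space \<open>H \<otimes> H\<close>.  Operations are
  computed on representatives; the lemmas at the end of this subsection show that the choice of
  representatives is irrelevant.
\<close>

type_synonym ('a, 'k) tensor2 = "('a \<times> 'a \<Rightarrow>\<^sub>0 'k) set"
type_synonym ('a, 'k) tensor3 = "('a \<times> 'a \<times> 'a \<Rightarrow>\<^sub>0 'k) set"

locale k_algebra = vector_space scale
  for scale :: "'k::field \<Rightarrow> 'a::ring_1 \<Rightarrow> 'a" (infixr \<open>*s\<close> 75) +
  assumes scale_mult_left: "c *s (x * y) = (c *s x) * y"
    and scale_mult_right: "c *s (x * y) = x * (c *s y)"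
begin

definition relations2 :: "('a \<times> 'a \<Rightarrow>\<^sub>0 'k) set" where
  "relations2 =
     {fbasis (x + x', y) - fbasis (x, y) - fbasis (x', y) | x x' y. True} \<union>
     {fbasis (x, y + y') - fbasis (x, y) - fbasis (x, y') | x y y'. True} \<union>
     {fbasis (c *s x, y) - fscale c (fbasis (x, y)) | c x y. True} \<union>
     {fbasis (x, c *s y) - fscale c (fbasis (x, y)) | c x y. True}"

definition relations3 :: "('a \<times> 'a \<times> 'a \<Rightarrow>\<^sub>0 'k) set" where
  "relations3 =
     {fbasis (x + x', y, z) - fbasis (x, y, z) - fbasis (x', y, z) | x x' y z. True} \<union>
     {fbasis (x, y + y', z) - fbasis (x, y, z) - fbasis (x, y', z) | x y y' z. True} \<union>
     {fbasis (x, y, z + z') - fbasis (x, y, z) - fbasis (x, y, z') | x y z z'. True} \<union>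
     {fbasis (c *s x, y, z) - fscale c (fbasis (x, y, z)) | c x y z. True} \<union>
     {fbasis (x, c *s y, z) - fscale c (fbasis (x, y, z)) | c x y z. True} \<union>
     {fbasis (x, y, c *s z) - fscale c (fbasis (x, y, z)) | c x y z. True}"

definition cls2 :: "('a \<times> 'a \<Rightarrow>\<^sub>0 'k) \<Rightarrow> ('a, 'k) tensor2" where
  "cls2 t = {u. u - t \<in> free.span relations2}"

definition cls3 :: "('a \<times> 'a \<times> 'a \<Rightarrow>\<^sub>0 'k) \<Rightarrow> ('a, 'k) tensor3" where
  "cls3 t = {u. u - t \<in> free.span relations3}"

definition T2 :: "('a, 'k) tensor2 set" where "T2 = range cls2"

definition tens2 :: "'a \<Rightarrow> 'a \<Rightarrow> ('a, 'k) tensor2" (infix \<open>\<otimes>\<close> 72) where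
  "x \<otimes> y = cls2 (fbasis (x, y))"

definition add2 :: "('a, 'k) tensor2 \<Rightarrow> ('a, 'k) tensor2 \<Rightarrow> ('a, 'k) tensor2" (infixl \<open>\<oplus>\<^sub>2\<close> 65) where
  "A \<oplus>\<^sub>2 B = cls2 (rep A + rep B)"

definition sub2 :: "('a, 'k) tensor2 \<Rightarrow> ('a, 'k) tensor2 \<Rightarrow> ('a, 'k) tensor2" (infixl \<open>\<ominus>\<^sub>2\<close> 65) where
  "A \<ominus>\<^sub>2 B = cls2 (rep A - rep B)"

definition scale2 :: "'k \<Rightarrow> ('a, 'k) tensor2 \<Rightarrow> ('a, 'k) tensor2" where
  "scale2 c A = cls2 (fscale c (rep A))"

definition mult2 :: "('a, 'k) tensor2 \<Rightarrow> ('a, 'k) tensor2 \<Rightarrow> ('a, 'k) tensor2" (infixl \<open>\<odot>\<^sub>2\<close> 70) where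
  "A \<odot>\<^sub>2 B = cls2 (fmult (\<lambda>(x, y) (x', y'). (x * x', y * y')) (rep A) (rep B))"

definition add3 :: "('a, 'k) tensor3 \<Rightarrow> ('a, 'k) tensor3 \<Rightarrow> ('a, 'k) tensor3" (infixl \<open>\<oplus>\<^sub>3\<close> 65) where
  "A \<oplus>\<^sub>3 B = cls3 (rep A + rep B)"

definition mult3 :: "('a, 'k) tensor3 \<Rightarrow> ('a, 'k) tensor3 \<Rightarrow> ('a, 'k) tensor3" (infixl \<open>\<odot>\<^sub>3\<close> 70) where
  "A \<odot>\<^sub>3 B = cls3 (fmult (\<lambda>(x, y, z) (x', y', z'). (x * x', y * y', z * z')) (rep A) (rep B))"

definition is_inverse2 :: "('a, 'k) tensor2 \<Rightarrow> ('a, 'k) tensor2 \<Rightarrow> bool" where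
  "is_inverse2 A B \<longleftrightarrow> B \<in> T2 \<and> A \<odot>\<^sub>2 B = 1 \<otimes> 1 \<and> B \<odot>\<^sub>2 A = 1 \<otimes> 1"

definition invertible2 :: "('a, 'k) tensor2 \<Rightarrow> bool" where
  "invertible2 A \<longleftrightarrow> A \<in> T2 \<and> (\<exists>B. is_inverse2 A B)"

definition inv2 :: "('a, 'k) tensor2 \<Rightarrow> ('a, 'k) tensor2" where
  "inv2 A = (THE B. is_inverse2 A B)"

definition flip :: "('a, 'k) tensor2 \<Rightarrow> ('a, 'k) tensor2" where
  "flip A = cls2 (fext (\<lambda>(x, y). fbasis (y, x)) (rep A))"

definition leg12 :: "('a, 'k) tensor2 \<Rightarrow> ('a, 'k) tensor3" where
  "leg12 A = cls3 (fext (\<lambda>(x, y). fbasis (x, y, 1)) (rep A))"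

definition leg13 :: "('a, 'k) tensor2 \<Rightarrow> ('a, 'k) tensor3" where
  "leg13 A = cls3 (fext (\<lambda>(x, y). fbasis (x, 1, y)) (rep A))"

definition leg23 :: "('a, 'k) tensor2 \<Rightarrow> ('a, 'k) tensor3" where
  "leg23 A = cls3 (fext (\<lambda>(x, y). fbasis (1, x, y)) (rep A))"

text \<open>\<open>Id \<otimes> f\<close> and \<open>f \<otimes> Id\<close> as maps \<open>H \<otimes> H \<rightarrow> H \<otimes> H \<otimes> H\<close>, for linear \<open>f: H \<rightarrow> H \<otimes> H\<close>.\<close>

definition id_tensor :: "('a \<Rightarrow> ('a, 'k) tensor2) \<Rightarrow> ('a, 'k) tensor2 \<Rightarrow> ('a, 'k) tensor3" where
  "id_tensor f A =
     cls3 (fext (\<lambda>(x, y). fext (\<lambda>(u, v). fbasis (x, u, v)) (rep (f y))) (rep A))"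

definition tensor_id :: "('a \<Rightarrow> ('a, 'k) tensor2) \<Rightarrow> ('a, 'k) tensor2 \<Rightarrow> ('a, 'k) tensor3" where
  "tensor_id f A =
     cls3 (fext (\<lambda>(x, y). fext (\<lambda>(u, v). fbasis (u, v, y)) (rep (f x))) (rep A))"

text \<open>The linear map \<open>H \<otimes> H \<rightarrow> H\<close>, \<open>x \<otimes> y \<mapsto> f x y\<close>, for bilinear \<open>f\<close>.\<close>

definition contract :: "('a \<Rightarrow> 'a \<Rightarrow> 'a) \<Rightarrow> ('a, 'k) tensor2 \<Rightarrow> 'a" where
  "contract f A = lin_ext scale (\<lambda>(x, y). f x y) (rep A)"

subsubsection \<open>Independence of representatives\<close>

lemma cls2_eq_iff: "cls2 t = cls2 u \<longleftrightarrow> t - u \<in> free.span relations2"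
proof
  assume "cls2 t = cls2 u"
  moreover have "t \<in> cls2 t" by (simp add: cls2_def free.span_zero)
  ultimately show "t - u \<in> free.span relations2" by (simp add: cls2_def)
next
  assume "t - u \<in> free.span relations2"
  moreover have "v - u = (v - t) + (t - u)" "v - t = (v - u) - (t - u)" for v by auto
  ultimately show "cls2 t = cls2 u"
    unfolding cls2_def by (metis free.span_add free.span_diff)
qed

lemma cls3_eq_iff: "cls3 t = cls3 u \<longleftrightarrow> t - u \<in> free.span relations3"
proof
  assume "cls3 t = cls3 u"
  moreover have "t \<in> cls3 t" by (simp add: cls3_def free.span_zero)
  ultimately show "t - u \<in> free.span relations3" by (simp add: cls3_def)
next
  assume "t - u \<in> free.span relations3"
  moreover have "v - u = (v - t) + (t - u)" "v - t = (v - u) - (t - u)" for v by auto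
  ultimately show "cls3 t = cls3 u"
    unfolding cls3_def by (metis free.span_add free.span_diff)
qed

lemma rep_cls2: "rep (cls2 t) - t \<in> free.span relations2"
proof -
  have "t \<in> cls2 t" by (simp add: cls2_def free.span_zero)
  hence "rep (cls2 t) \<in> cls2 t" unfolding rep_def by (rule someI)
  thus ?thesis by (simp add: cls2_def)
qed

lemma rep_cls3: "rep (cls3 t) - t \<in> free.span relations3"
proof -
  have "t \<in> cls3 t" by (simp add: cls3_def free.span_zero)
  hence "rep (cls3 t) \<in> cls3 t" unfolding rep_def by (rule someI)
  thus ?thesis by (simp add: cls3_def)
qed

lemma cls2_rep: "A \<in> T2 \<Longrightarrow> cls2 (rep A) = A"
  unfolding T2_def using cls2_eq_iff rep_cls2 by blast

lemma add2_cls2: "cls2 t \<oplus>\<^sub>2 cls2 u = cls2 (t + u)"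
  unfolding add2_def cls2_eq_iff
  using free.span_add[OF rep_cls2[of t] rep_cls2[of u]] by (simp add: algebra_simps)

lemma sub2_cls2: "cls2 t \<ominus>\<^sub>2 cls2 u = cls2 (t - u)"
  unfolding sub2_def cls2_eq_iff
  using free.span_diff[OF rep_cls2[of t] rep_cls2[of u]] by (simp add: algebra_simps)

lemma scale2_cls2: "scale2 c (cls2 t) = cls2 (fscale c t)"
  unfolding scale2_def cls2_eq_iff
  using free.span_scale[OF rep_cls2[of t], of c] by (simp add: free.scale_right_diff_distrib)

lemma add3_cls3: "cls3 t \<oplus>\<^sub>3 cls3 u = cls3 (t + u)"
  unfolding add3_def cls3_eq_iff
  using free.span_add[OF rep_cls3[of t] rep_cls3[of u]] by (simp add: algebra_simps)

lemma null2I: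
  "fbasis (x + x', y) - fbasis (x, y) - fbasis (x', y) \<in> free.span relations2"
  "fbasis (x, y + y') - fbasis (x, y) - fbasis (x, y') \<in> free.span relations2"
  "fbasis (c *s x, y) - fscale c (fbasis (x, y)) \<in> free.span relations2"
  "fbasis (x, c *s y) - fscale c (fbasis (x, y)) \<in> free.span relations2"
  unfolding relations2_def by (rule free.span_base, simp only: Un_iff mem_Collect_eq, metis)+

lemma null3I:
  "fbasis (x + x', y, z) - fbasis (x, y, z) - fbasis (x', y, z) \<in> free.span relations3"
  "fbasis (x, y + y', z) - fbasis (x, y, z) - fbasis (x, y', z) \<in> free.span relations3"
  "fbasis (x, y, z + z') - fbasis (x, y, z) - fbasis (x, y, z') \<in> free.span relations3"
  "fbasis (c *s x, y, z) - fscale c (fbasis (x, y, z)) \<in> free.span relations3"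
  "fbasis (x, c *s y, z) - fscale c (fbasis (x, y, z)) \<in> free.span relations3"
  "fbasis (x, y, c *s z) - fscale c (fbasis (x, y, z)) \<in> free.span relations3"
  unfolding relations3_def by (rule free.span_base, simp only: Un_iff mem_Collect_eq, metis)+

lemma fext_null2:
  assumes "\<And>x x' y. F (x + x', y) - F (x, y) - F (x', y) \<in> N"
    and "\<And>x y y'. F (x, y + y') - F (x, y) - F (x, y') \<in> N"
    and "\<And>c x y. F (c *s x, y) - fscale c (F (x, y)) \<in> N"
    and "\<And>c x y. F (x, c *s y) - fscale c (F (x, y)) \<in> N"
    and "free.subspace N" "t \<in> free.span relations2"
  shows "fext F t \<in> N"
  by (rule free.lin_ext_span[OF _ assms(5) assms(6)])
    (use assms(1-4) in \<open>auto simp: relations2_def free.lin_ext_diff free.lin_ext_fscale\<close>)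

lemma fext_null3:
  assumes "\<And>x x' y z. F (x + x', y, z) - F (x, y, z) - F (x', y, z) \<in> N"
    and "\<And>x y y' z. F (x, y + y', z) - F (x, y, z) - F (x, y', z) \<in> N"
    and "\<And>x y z z'. F (x, y, z + z') - F (x, y, z) - F (x, y, z') \<in> N"
    and "\<And>c x y z. F (c *s x, y, z) - fscale c (F (x, y, z)) \<in> N"
    and "\<And>c x y z. F (x, c *s y, z) - fscale c (F (x, y, z)) \<in> N"
    and "\<And>c x y z. F (x, y, c *s z) - fscale c (F (x, y, z)) \<in> N"
    and "free.subspace N" "t \<in> free.span relations3"
  shows "fext F t \<in> N"
  by (rule free.lin_ext_span[OF _ assms(7) assms(8)])
    (use assms(1-6) in \<open>auto simp: relations3_def free.lin_ext_diff free.lin_ext_fscale\<close>)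

lemma flip_cls2: "flip (cls2 t) = cls2 (fext (\<lambda>(x, y). fbasis (y, x)) t)"
  unfolding flip_def cls2_eq_iff free.lin_ext_diff[symmetric]
  by (rule fext_null2[OF _ _ _ _ free.subspace_span rep_cls2]) (auto intro: null2I)

lemma leg12_cls2: "leg12 (cls2 t) = cls3 (fext (\<lambda>(x, y). fbasis (x, y, 1)) t)"
  unfolding leg12_def cls3_eq_iff free.lin_ext_diff[symmetric]
  by (rule fext_null2[OF _ _ _ _ free.subspace_span rep_cls2]) (auto intro: null3I)

lemma leg13_cls2: "leg13 (cls2 t) = cls3 (fext (\<lambda>(x, y). fbasis (x, 1, y)) t)"
  unfolding leg13_def cls3_eq_iff free.lin_ext_diff[symmetric]
  by (rule fext_null2[OF _ _ _ _ free.subspace_span rep_cls2]) (auto intro: null3I)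

lemma leg23_cls2: "leg23 (cls2 t) = cls3 (fext (\<lambda>(x, y). fbasis (1, x, y)) t)"
  unfolding leg23_def cls3_eq_iff free.lin_ext_diff[symmetric]
  by (rule fext_null2[OF _ _ _ _ free.subspace_span rep_cls2]) (auto intro: null3I)

lemma mult2_cls2:
  "cls2 t \<odot>\<^sub>2 cls2 u = cls2 (fmult (\<lambda>(x, y) (x', y'). (x * x', y * y')) t u)"
proof -
  let ?opr = "\<lambda>(x, y) (x', y'). (x * x', y * y') :: 'a \<times> 'a"
  let ?N = "free.span relations2"
  note simps = split_def fst_conv snd_conv distrib_left distrib_right
    scale_mult_left[symmetric] scale_mult_right[symmetric]
  have 1: "fmult ?opr v w \<in> ?N" if "v \<in> ?N" for v w
    unfolding fmult_def
    by (rule fext_null2[OF _ _ _ _ free.subspace_span that];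
        unfold free.lin_ext_fun_diff free.lin_ext_fun_scale;
        rule free.lin_ext_mem[OF _ free.subspace_span];
        simp only: simps null2I)
  have 2: "fmult ?opr v w \<in> ?N" if "w \<in> ?N" for v w
    unfolding fmult_def
    by (rule free.lin_ext_mem[OF _ free.subspace_span];
        rule fext_null2[OF _ _ _ _ free.subspace_span that];
        simp only: simps null2I)
  have "fmult ?opr (rep (cls2 t)) (rep (cls2 u)) - fmult ?opr t u =
      fmult ?opr (rep (cls2 t) - t) (rep (cls2 u)) + fmult ?opr t (rep (cls2 u) - u)"
    by (simp add: fmult_def free.lin_ext_diff free.lin_ext_fun_diff[symmetric])
  also have "\<dots> \<in> ?N"
    by (intro free.span_add 1 2 rep_cls2)
  finally show ?thesis unfolding mult2_def cls2_eq_iff .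
qed

lemma mult3_cls3:
  "cls3 t \<odot>\<^sub>3 cls3 u = cls3 (fmult (\<lambda>(x, y, z) (x', y', z'). (x * x', y * y', z * z')) t u)"
proof -
  let ?opr = "\<lambda>(x, y, z) (x', y', z'). (x * x', y * y', z * z') :: 'a \<times> 'a \<times> 'a"
  let ?N = "free.span relations3"
  note simps = split_def fst_conv snd_conv distrib_left distrib_right
    scale_mult_left[symmetric] scale_mult_right[symmetric]
  have 1: "fmult ?opr v w \<in> ?N" if "v \<in> ?N" for v w
    unfolding fmult_def
    by (rule fext_null3[OF _ _ _ _ _ _ free.subspace_span that];
        unfold free.lin_ext_fun_diff free.lin_ext_fun_scale;
        rule free.lin_ext_mem[OF _ free.subspace_span];
        simp only: simps null3I)
  have 2: "fmult ?opr v w \<in> ?N" if "w \<in> ?N" for v w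
    unfolding fmult_def
    by (rule free.lin_ext_mem[OF _ free.subspace_span];
        rule fext_null3[OF _ _ _ _ _ _ free.subspace_span that];
        simp only: simps null3I)
  have "fmult ?opr (rep (cls3 t)) (rep (cls3 u)) - fmult ?opr t u =
      fmult ?opr (rep (cls3 t) - t) (rep (cls3 u)) + fmult ?opr t (rep (cls3 u) - u)"
    by (simp add: fmult_def free.lin_ext_diff free.lin_ext_fun_diff[symmetric])
  also have "\<dots> \<in> ?N"
    by (intro free.span_add 1 2 rep_cls3)
  finally show ?thesis unfolding mult3_def cls3_eq_iff .
qed

lemma mult2_tens2: "(x \<otimes> y) \<odot>\<^sub>2 (x' \<otimes> y') = (x * x') \<otimes> (y * y')"
  by (simp add: tens2_def mult2_cls2 fmult_def)

lemma contract_cls2: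
  assumes "\<And>x x' y. f (x + x') y = f x y + f x' y" "\<And>x y y'. f x (y + y') = f x y + f x y'"
    and "\<And>c x y. f (c *s x) y = c *s f x y" "\<And>c x y. f x (c *s y) = c *s f x y"
  shows "contract f (cls2 t) = lin_ext scale (\<lambda>(x, y). f x y) t"
proof -
  have "lin_ext scale (\<lambda>(x, y). f x y) (rep (cls2 t) - t) \<in> {0}"
    by (rule lin_ext_span[OF _ _ rep_cls2])
      (use assms in \<open>auto simp: relations2_def lin_ext_diff lin_ext_fscale subspace_def\<close>)
  thus ?thesis by (simp add: contract_def lin_ext_diff)
qed

lemma id_tensor_cls2:
  assumes "\<And>x. f x \<in> T2" "\<And>x y. f (x + y) = f x \<oplus>\<^sub>2 f y" "\<And>c x. f (c *s x) = scale2 c (f x)"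
  shows "id_tensor f (cls2 t) =
    cls3 (fext (\<lambda>(x, y). fext (\<lambda>(u, v). fbasis (x, u, v)) (rep (f y))) t)"
proof -
  have add: "rep (f (x + y)) - rep (f x) - rep (f y) \<in> free.span relations2" for x y
    using rep_cls2[of "rep (f x) + rep (f y)"] by (simp add: assms(2) add2_def algebra_simps)
  have scl: "rep (f (c *s x)) - fscale c (rep (f x)) \<in> free.span relations2" for c x
    using rep_cls2[of "fscale c (rep (f x))"] by (simp add: assms(3) scale2_def)
  have ext: "fext (\<lambda>(u, v). fbasis (x, u, v)) r \<in> free.span relations3"
    if "r \<in> free.span relations2" for x r
    by (rule fext_null2[OF _ _ _ _ free.subspace_span that]) (auto intro: null3I)
  show ?thesis
    unfolding id_tensor_def cls3_eq_iff free.lin_ext_diff[symmetric]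
  proof (rule fext_null2[OF _ _ _ _ free.subspace_span rep_cls2]; unfold prod.case)
    fix x x' y
    show "fext (\<lambda>(u, v). fbasis (x + x', u, v)) (rep (f y)) - fext (\<lambda>(u, v). fbasis (x, u, v)) (rep (f y))
        - fext (\<lambda>(u, v). fbasis (x', u, v)) (rep (f y)) \<in> free.span relations3"
      unfolding free.lin_ext_fun_diff
      by (rule free.lin_ext_mem[OF _ free.subspace_span]) (simp only: split_def null3I)
  next
    fix x y y'
    show "fext (\<lambda>(u, v). fbasis (x, u, v)) (rep (f (y + y'))) - fext (\<lambda>(u, v). fbasis (x, u, v)) (rep (f y))
        - fext (\<lambda>(u, v). fbasis (x, u, v)) (rep (f y')) \<in> free.span relations3"
      unfolding free.lin_ext_diff[symmetric] by (rule ext[OF add])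
  next
    fix c x y
    show "fext (\<lambda>(u, v). fbasis (c *s x, u, v)) (rep (f y))
        - fscale c (fext (\<lambda>(u, v). fbasis (x, u, v)) (rep (f y))) \<in> free.span relations3"
      unfolding free.lin_ext_fun_scale free.lin_ext_fun_diff
      by (rule free.lin_ext_mem[OF _ free.subspace_span]) (simp only: split_def null3I)
  next
    fix c x y
    show "fext (\<lambda>(u, v). fbasis (x, u, v)) (rep (f (c *s y)))
        - fscale c (fext (\<lambda>(u, v). fbasis (x, u, v)) (rep (f y))) \<in> free.span relations3"
      unfolding free.lin_ext_diff[symmetric] free.lin_ext_fscale[symmetric] by (rule ext[OF scl])
  qed
qed

lemma tensor_id_cls2:
  assumes "\<And>x. f x \<in> T2" "\<And>x y. f (x + y) = f x \<oplus>\<^sub>2 f y" "\<And>c x. f (c *s x) = scale2 c (f x)"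
  shows "tensor_id f (cls2 t) =
    cls3 (fext (\<lambda>(x, y). fext (\<lambda>(u, v). fbasis (u, v, y)) (rep (f x))) t)"
proof -
  have add: "rep (f (x + y)) - rep (f x) - rep (f y) \<in> free.span relations2" for x y
    using rep_cls2[of "rep (f x) + rep (f y)"] by (simp add: assms(2) add2_def algebra_simps)
  have scl: "rep (f (c *s x)) - fscale c (rep (f x)) \<in> free.span relations2" for c x
    using rep_cls2[of "fscale c (rep (f x))"] by (simp add: assms(3) scale2_def)
  have ext: "fext (\<lambda>(u, v). fbasis (u, v, y)) r \<in> free.span relations3"
    if "r \<in> free.span relations2" for y r
    by (rule fext_null2[OF _ _ _ _ free.subspace_span that]) (auto intro: null3I)
  show ?thesis
    unfolding tensor_id_def cls3_eq_iff free.lin_ext_diff[symmetric]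
  proof (rule fext_null2[OF _ _ _ _ free.subspace_span rep_cls2]; unfold prod.case)
    fix x x' y
    show "fext (\<lambda>(u, v). fbasis (u, v, y)) (rep (f (x + x'))) - fext (\<lambda>(u, v). fbasis (u, v, y)) (rep (f x))
        - fext (\<lambda>(u, v). fbasis (u, v, y)) (rep (f x')) \<in> free.span relations3"
      unfolding free.lin_ext_diff[symmetric] by (rule ext[OF add])
  next
    fix x y y'
    show "fext (\<lambda>(u, v). fbasis (u, v, y + y')) (rep (f x)) - fext (\<lambda>(u, v). fbasis (u, v, y)) (rep (f x))
        - fext (\<lambda>(u, v). fbasis (u, v, y')) (rep (f x)) \<in> free.span relations3"
      unfolding free.lin_ext_fun_diff
      by (rule free.lin_ext_mem[OF _ free.subspace_span]) (simp only: split_def null3I)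
  next
    fix c x y
    show "fext (\<lambda>(u, v). fbasis (u, v, y)) (rep (f (c *s x)))
        - fscale c (fext (\<lambda>(u, v). fbasis (u, v, y)) (rep (f x))) \<in> free.span relations3"
      unfolding free.lin_ext_diff[symmetric] free.lin_ext_fscale[symmetric] by (rule ext[OF scl])
  next
    fix c x y
    show "fext (\<lambda>(u, v). fbasis (u, v, c *s y)) (rep (f x))
        - fscale c (fext (\<lambda>(u, v). fbasis (u, v, y)) (rep (f x))) \<in> free.span relations3"
      unfolding free.lin_ext_fun_scale free.lin_ext_fun_diff
      by (rule free.lin_ext_mem[OF _ free.subspace_span]) (simp only: split_def null3I)
  qed
qed

end


subsection \<open>Hopf algebras and infinitesimal R-matrices\<close>

locale hopf_algebra = k_algebra scale
  for scale :: "'k::field \<Rightarrow> 'a::ring_1 \<Rightarrow> 'a" (infixr \<open>*s\<close> 75) +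
  fixes \<Delta> :: "'a \<Rightarrow> ('a, 'k) tensor2"
    and \<epsilon> :: "'a \<Rightarrow> 'k"
    and S :: "'a \<Rightarrow> 'a"
  assumes comult_mem: "\<Delta> h \<in> T2"
    and comult_add: "\<Delta> (g + h) = \<Delta> g \<oplus>\<^sub>2 \<Delta> h"
    and comult_scale: "\<Delta> (c *s h) = scale2 c (\<Delta> h)"
    and comult_mult: "\<Delta> (g * h) = \<Delta> g \<odot>\<^sub>2 \<Delta> h"
    and comult_one: "\<Delta> 1 = 1 \<otimes> 1"
    and counit_linear: "Vector_Spaces.linear scale (*) \<epsilon>"
    and counit_mult: "\<epsilon> (g * h) = \<epsilon> g * \<epsilon> h"
    and counit_one: "\<epsilon> 1 = 1"
    and coassoc: "tensor_id \<Delta> (\<Delta> h) = id_tensor \<Delta> (\<Delta> h)"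
    and counit_left: "contract (\<lambda>x y. \<epsilon> x *s y) (\<Delta> h) = h"
    and counit_right: "contract (\<lambda>x y. \<epsilon> y *s x) (\<Delta> h) = h"
    and antipode_linear: "Vector_Spaces.linear scale scale S"
    and antipode_left: "contract (\<lambda>x y. S x * y) (\<Delta> h) = \<epsilon> h *s 1"
    and antipode_right: "contract (\<lambda>x y. x * S y) (\<Delta> h) = \<epsilon> h *s 1"
begin

definition primitive :: "'a \<Rightarrow> bool" where
  "primitive p \<longleftrightarrow> \<Delta> p = p \<otimes> 1 \<oplus>\<^sub>2 1 \<otimes> p"

definition b1 :: "'a \<Rightarrow> ('a, 'k) tensor2" where
  "b1 a = 1 \<otimes> a \<ominus>\<^sub>2 \<Delta> a \<oplus>\<^sub>2 a \<otimes> 1"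

end

locale quasitriangular_hopf_algebra = hopf_algebra scale \<Delta> \<epsilon> S
  for scale :: "'k::field \<Rightarrow> 'a::ring_1 \<Rightarrow> 'a" (infixr \<open>*s\<close> 75)
    and \<Delta> :: "'a \<Rightarrow> ('a, 'k) tensor2"
    and \<epsilon> :: "'a \<Rightarrow> 'k"
    and S :: "'a \<Rightarrow> 'a" +
  fixes R :: "('a, 'k) tensor2"
  assumes R_invertible: "invertible2 R"
    and R_comult: "flip (\<Delta> h) = R \<odot>\<^sub>2 \<Delta> h \<odot>\<^sub>2 inv2 R"
    and R_id_comult: "id_tensor \<Delta> R = leg13 R \<odot>\<^sub>3 leg12 R"
    and R_comult_id: "tensor_id \<Delta> R = leg13 R \<odot>\<^sub>3 leg23 R"

text \<open>
  Since \<open>T \<mapsto> T\<^sub>1\<^sub>2\<close> and \<open>T \<mapsto> T\<^sub>2\<^sub>3\<close> are unital algebra maps, \<open>R\<^sub>1\<^sub>2\<close> and \<open>R\<^sub>2\<^sub>3\<close> have the inverses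
  \<open>leg12 (inv2 R)\<close> and \<open>leg23 (inv2 R)\<close>.
\<close>

locale pre_cartier = quasitriangular_hopf_algebra scale \<Delta> \<epsilon> S R
  for scale :: "'k::field \<Rightarrow> 'a::ring_1 \<Rightarrow> 'a" (infixr \<open>*s\<close> 75)
    and \<Delta> :: "'a \<Rightarrow> ('a, 'k) tensor2"
    and \<epsilon> :: "'a \<Rightarrow> 'k"
    and S :: "'a \<Rightarrow> 'a"
    and R :: "('a, 'k) tensor2" +
  fixes \<chi> :: "('a, 'k) tensor2"
  assumes chi_mem: "\<chi> \<in> T2"
    and chi_comult: "\<chi> \<odot>\<^sub>2 \<Delta> h = \<Delta> h \<odot>\<^sub>2 \<chi>"
    and chi_id_comult: "id_tensor \<Delta> \<chi> = leg12 \<chi> \<oplus>\<^sub>3 leg12 (inv2 R) \<odot>\<^sub>3 leg13 \<chi> \<odot>\<^sub>3 leg12 R"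
    and chi_comult_id: "tensor_id \<Delta> \<chi> = leg23 \<chi> \<oplus>\<^sub>3 leg23 (inv2 R) \<odot>\<^sub>3 leg13 \<chi> \<odot>\<^sub>3 leg23 R"

locale cartier = pre_cartier +
  assumes chi_cartier: "R \<odot>\<^sub>2 \<chi> = flip \<chi> \<odot>\<^sub>2 R"

end

theory Submission
  imports Defs
begin

text \<open>
  For every pre-Cartier structure, \<open>(S \<otimes> S)(\<chi>) = R \<chi> R\<^sup>-\<^sup>1\<close>: contracting the hexagon axioms for
  \<open>(\<Delta> \<otimes> Id)(\<chi>)\<close> and \<open>(Id \<otimes> \<Delta>)(\<chi>)\<close> with the antipode expresses \<open>\<chi>\<close> and \<open>(S \<otimes> S)(\<chi>)\<close> through
  one and the same tensor.  Hence \<open>\<chi>\<close> is Cartier iff it equals its image under \<open>S \<otimes> S\<close> followed by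
  the flip.  Since \<open>\<Delta>(S(h)) = (S \<otimes> S)(\<Delta>\<^sup>o\<^sup>p(h))\<close>, this image is \<open>b\<^sup>1(S(a))\<close> when \<open>\<chi> = b\<^sup>1(a)\<close>, and
  \<open>b\<^sup>1(a) = b\<^sup>1(S(a))\<close> says that \<open>a - S(a)\<close> is primitive.

  Identities between tensors are checked by evaluating arbitrary multilinear forms on both sides:
  \<open>ap2 (\<lambda>x y. f x y) A\<close> stands for Sweedler's \<open>f(A\<^sup>i, A\<^sub>i)\<close>.
\<close>

subsection \<open>Evaluating multilinear forms on tensors\<close>

interpretation ground: vector_space "(*) :: 'k::field \<Rightarrow> 'k \<Rightarrow> 'k"
  by unfold_locales (simp_all add: algebra_simps)

text \<open>This instance of the rule undoes \<open>mult.assoc\<close>.\<close>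

declare ground.scale_scale [simp del]

section \<open>Linear extensions and separating functionals\<close>

context vector_space
begin

lemma lin_ext_sum: "lin_ext scale f (\<Sum>i\<in>I. t i) = (\<Sum>i\<in>I. lin_ext scale f (t i))"
proof (cases "finite I")
  case True
  thus ?thesis
    by induction (simp_all add: lin_ext_add, simp add: lin_ext_def)
qed (simp add: lin_ext_def)

lemma lin_ext_fext: "lin_ext scale f (fext g t) = lin_ext scale (\<lambda>x. lin_ext scale f (g x)) t"
proof -
  have "lin_ext scale f (fext g t) =
      lin_ext scale f (\<Sum>x\<in>Poly_Mapping.keys t. fscale (Poly_Mapping.lookup t x) (g x))"
    by (simp add: lin_ext_def[of fscale])
  thus ?thesis
    by (simp add: lin_ext_sum lin_ext_fscale lin_ext_def[of _ "\<lambda>x. lin_ext scale f (g x)"])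
qed

text \<open>A maximal independent subset of \<open>X\<close> stays independent when \<open>t\<close>
  is added, so the values 1 at \<open>t\<close> and 0 on that subset extend to a linear
  functional.\<close>

lemma separating_form:
  assumes "t \<notin> span X"
  obtains \<phi> where "Vector_Spaces.linear scale (*) \<phi>" "\<And>x. x \<in> span X \<Longrightarrow> \<phi> x = 0" "\<phi> t = 1"
proof -
  interpret pair: vector_space_pair scale "(*) :: 'a \<Rightarrow> 'a \<Rightarrow> 'a"
    by unfold_locales
  obtain B where B: "B \<subseteq> X" "independent B" "X \<subseteq> span B"
    using maximal_independent_subset by blast
  have t: "t \<notin> span B"
    using assms span_mono[OF B(1)] by blast
  have "independent (insert t B)"
    by (rule independent_insertI[OF t B(2)])
  then obtain \<phi> where \<phi>: "Vector_Spaces.linear scale (*) \<phi>"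
      "\<forall>x\<in>insert t B. \<phi> x = (if x = t then 1 else 0)"
    using pair.linear_independent_extend[of "insert t B" "\<lambda>x. if x = t then 1 else 0"] by blast
  have *: "\<phi> x = 0" if "x \<in> B" for x
    using that \<phi>(2) t span_base by auto
  have "\<phi> x = 0" if "x \<in> span X" for x
  proof (rule pair.linear_eq_0_on_span[OF \<phi>(1) *])
    show "x \<in> span B"
      using that B(3) span_mono[of X "span B"] by (auto simp: span_span)
  qed
  with \<phi> show ?thesis
    by (intro that[of \<phi>]) auto
qed

end

lemma ground_lin_ext_swap:
  "lin_ext (*) (\<lambda>x. lin_ext (*) (g x) u) t = lin_ext (*) (\<lambda>y. lin_ext (*) (\<lambda>x. g x y) t) u"
  unfolding lin_ext_def sum_distrib_left
  by (rule trans[OF sum.swap]) (intro sum.cong refl mult.left_commute)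

section \<open>Multilinear forms and their values on tensors\<close>

context k_algebra
begin

definition form1 :: "('a \<Rightarrow> 'k) \<Rightarrow> bool" where
  "form1 \<phi> \<longleftrightarrow> (\<forall>x y. \<phi> (x + y) = \<phi> x + \<phi> y) \<and> (\<forall>c x. \<phi> (c *s x) = c * \<phi> x)"

definition form2 :: "('a \<Rightarrow> 'a \<Rightarrow> 'k) \<Rightarrow> bool" where
  "form2 f \<longleftrightarrow> (\<forall>y. form1 (\<lambda>x. f x y)) \<and> (\<forall>x. form1 (\<lambda>y. f x y))"

definition form3 :: "('a \<Rightarrow> 'a \<Rightarrow> 'a \<Rightarrow> 'k) \<Rightarrow> bool" where
  "form3 f \<longleftrightarrow> (\<forall>y z. form1 (\<lambda>x. f x y z)) \<and> (\<forall>x z. form1 (\<lambda>y. f x y z)) \<and>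
     (\<forall>x y. form1 (\<lambda>z. f x y z))"

definition endo :: "('a \<Rightarrow> 'a) \<Rightarrow> bool" where
  "endo g \<longleftrightarrow> (\<forall>x y. g (x + y) = g x + g y) \<and> (\<forall>c x. g (c *s x) = c *s g x)"

text \<open>Summation over one chosen representative makes sense for every \<open>f\<close>, so
  rules such as \<open>ap2_add\<close> and \<open>ap2_swap\<close> are plain identities of finite
  sums. Independence of the representative holds for bilinear \<open>f\<close>, by
  \<open>ap2_cls2\<close>.\<close>

definition ap2 :: "('a \<Rightarrow> 'a \<Rightarrow> 'k) \<Rightarrow> ('a, 'k) tensor2 \<Rightarrow> 'k" where
  "ap2 f A = lin_ext (*) (\<lambda>(x, y). f x y) (rep A)"

definition ap3 :: "('a \<Rightarrow> 'a \<Rightarrow> 'a \<Rightarrow> 'k) \<Rightarrow> ('a, 'k) tensor3 \<Rightarrow> 'k" where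
  "ap3 f A = lin_ext (*) (\<lambda>(x, y, z). f x y z) (rep A)"

definition map2 :: "('a \<Rightarrow> 'a) \<Rightarrow> ('a \<Rightarrow> 'a) \<Rightarrow> ('a, 'k) tensor2 \<Rightarrow> ('a, 'k) tensor2" where
  "map2 g h A = cls2 (fext (\<lambda>(x, y). fbasis (g x, h y)) (rep A))"

text \<open>These rules follow the syntax of a Sweedler expression: \<open>intro multilin\<close>
  proves linearity in one variable by peeling off evaluations, products and maps until the variable
  itself remains.\<close>

named_theorems multilin

lemma form2I [multilin]:
  "(\<And>y. form1 (\<lambda>x. f x y)) \<Longrightarrow> (\<And>x. form1 (\<lambda>y. f x y)) \<Longrightarrow> form2 f"
  by (simp add: form2_def)

lemma form3I [multilin]:
  "(\<And>y z. form1 (\<lambda>x. f x y z)) \<Longrightarrow> (\<And>x z. form1 (\<lambda>y. f x y z)) \<Longrightarrow>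
   (\<And>x y. form1 (\<lambda>z. f x y z)) \<Longrightarrow> form3 f"
  by (simp add: form3_def)

text \<open>In this generality the conclusion would match every functional, so only the instances
  for a fixed form enter \<open>multilin\<close>, by a \<open>note\<close> inside each proof. The
  same holds for \<open>form2_comp\<close> and \<open>form3_comp\<close>.\<close>

lemma form1_comp: "form1 \<phi> \<Longrightarrow> endo g \<Longrightarrow> form1 (\<lambda>x. \<phi> (g x))"
  by (simp add: form1_def endo_def)

lemma form2_comp:
  assumes "form2 f" "endo g"
  shows "form1 (\<lambda>x. f (g x) c)" "form1 (\<lambda>x. f c (g x))"
  using assms by (auto simp: form2_def form1_def endo_def)

lemma form3_comp:
  assumes "form3 f" "endo g"
  shows "form1 (\<lambda>x. f (g x) c d)" "form1 (\<lambda>x. f c (g x) d)" "form1 (\<lambda>x. f c d (g x))"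
  using assms by (auto simp: form3_def form1_def endo_def)

lemma form1_mult [multilin]:
  "form1 \<phi> \<Longrightarrow> form1 (\<lambda>x. c * \<phi> x)" "form1 \<phi> \<Longrightarrow> form1 (\<lambda>x. \<phi> x * c)"
  by (simp_all add: form1_def distrib_left distrib_right mult.assoc mult.left_commute)

lemma endo_id [multilin]: "endo (\<lambda>x. x)"
  by (simp add: endo_def)

lemma endo_mult [multilin]:
  "endo g \<Longrightarrow> endo (\<lambda>x. c * g x)" "endo g \<Longrightarrow> endo (\<lambda>x. g x * c)"
  by (simp_all add: endo_def distrib_left distrib_right scale_mult_left[symmetric] scale_mult_right[symmetric])

lemma ap2_add: "ap2 (\<lambda>x y. f x y + g x y) A = ap2 f A + ap2 g A"
  by (simp add: ap2_def split_def ground.lin_ext_fun_add)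

lemma ap2_cmult: "ap2 (\<lambda>x y. c * f x y) A = c * ap2 f A"
  by (simp add: ap2_def split_def ground.lin_ext_fun_scale)

lemma ap2_uminus: "ap2 (\<lambda>x y. - f x y) A = - ap2 f A"
  using ap2_cmult[of "-1"] by simp

lemma form1_ap2 [multilin]:
  assumes "\<And>x y. form1 (\<lambda>z. g z x y)"
  shows "form1 (\<lambda>z. ap2 (\<lambda>x y. g z x y) A)"
proof -
  have "g (z + z') = (\<lambda>x y. g z x y + g z' x y)" "g (c *s z) = (\<lambda>x y. c * g z x y)" for z z' c
    using assms by (auto simp: form1_def fun_eq_iff)
  thus ?thesis
    by (simp add: form1_def ap2_add ap2_cmult)
qed

lemma ap2_swap: "ap2 (\<lambda>x y. ap2 (\<lambda>u v. g x y u v) B) A = ap2 (\<lambda>u v. ap2 (\<lambda>x y. g x y u v) A) B"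
  unfolding ap2_def split_def by (rule ground_lin_ext_swap)

text \<open>A bilinear form annihilates each generator in \<open>relations2\<close>, hence the
  difference of two representatives.\<close>

lemma ap2_cls2:
  assumes "form2 f"
  shows "ap2 f (cls2 t) = lin_ext (*) (\<lambda>(x, y). f x y) t"
proof -
  have "lin_ext (*) (\<lambda>(x, y). f x y) (rep (cls2 t) - t) \<in> {0}"
    by (rule ground.lin_ext_span[OF _ _ rep_cls2])
      (use assms in \<open>auto simp: relations2_def ground.lin_ext_diff ground.lin_ext_fscale
         ground.subspace_def form2_def form1_def\<close>)
  thus ?thesis by (simp add: ap2_def ground.lin_ext_diff)
qed

lemma ap3_cls3:
  assumes "form3 f"
  shows "ap3 f (cls3 t) = lin_ext (*) (\<lambda>(x, y, z). f x y z) t"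
proof -
  have "lin_ext (*) (\<lambda>(x, y, z). f x y z) (rep (cls3 t) - t) \<in> {0}"
    by (rule ground.lin_ext_span[OF _ _ rep_cls3])
      (use assms in \<open>auto simp: relations3_def ground.lin_ext_diff ground.lin_ext_fscale
         ground.subspace_def form3_def form1_def\<close>)
  thus ?thesis by (simp add: ap3_def ground.lin_ext_diff)
qed

text \<open>Linear functionals separate points: a nonzero difference lies outside the span of the
  empty set, so \<open>separating_form\<close> applies.\<close>

lemma eq_if_forms_eq:
  assumes "\<And>\<phi>. form1 \<phi> \<Longrightarrow> \<phi> x = \<phi> y"
  shows "x = y"
proof (rule ccontr)
  assume "x \<noteq> y"
  hence "x - y \<notin> span {}" by (simp add: span_empty)
  then obtain \<phi> where \<phi>: "Vector_Spaces.linear scale (*) \<phi>" "\<phi> (x - y) = 1"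
    by (rule separating_form)
  interpret \<phi>: Vector_Spaces.linear scale "(*)" \<phi> by (rule \<phi>(1))
  have "form1 \<phi>"
    by (simp add: form1_def \<phi>.add \<phi>.scale)
  with assms have "\<phi> x = \<phi> y" by blast
  thus False
    using \<phi>(2) by (simp add: \<phi>.diff)
qed

text \<open>A functional on the free vector space that vanishes on the relations is a bilinear form,
  which is why bilinear forms separate tensors.\<close>

lemma tensor2_eqI:
  assumes "A \<in> T2" "B \<in> T2" "\<And>f. form2 f \<Longrightarrow> ap2 f A = ap2 f B"
  shows "A = B"
proof -
  obtain t u where tu: "A = cls2 t" "B = cls2 u"
    using assms(1,2) by (auto simp: T2_def)
  have "t - u \<in> free.span relations2"
  proof (rule ccontr)
    assume "t - u \<notin> free.span relations2"
    then obtain \<phi> where \<phi>: "Vector_Spaces.linear fscale (*) \<phi>"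
        "\<And>r. r \<in> free.span relations2 \<Longrightarrow> \<phi> r = 0" "\<phi> (t - u) = 1"
      by (rule free.separating_form) blast
    interpret \<phi>: Vector_Spaces.linear fscale "(*)" \<phi> by (rule \<phi>(1))
    let ?f = "\<lambda>x y. \<phi> (fbasis (x, y))"
    have "form2 ?f"
      using \<phi>(2)[OF null2I(1)] \<phi>(2)[OF null2I(2)] \<phi>(2)[OF null2I(3)] \<phi>(2)[OF null2I(4)]
      by (simp add: form2_def form1_def \<phi>.diff \<phi>.scale \<phi>.add diff_diff_eq)
    moreover have ext: "lin_ext (*) (\<lambda>(x, y). ?f x y) r = \<phi> r" for r
    proof -
      \<comment> \<open>Expanding \<open>r\<close> in the basis shows that \<open>\<phi>\<close> is
        the linear extension of its values on basis elements, which are the values of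
        \<open>?f\<close>.\<close>
      have "r = fext fbasis r"
      proof (rule poly_mapping_eqI)
        fix p
        have "Poly_Mapping.lookup (fext fbasis r) p =
            (\<Sum>x\<in>Poly_Mapping.keys r. Poly_Mapping.lookup r x * (1 when x = p))"
          by (simp add: lin_ext_def lookup_sum lookup_single)
        thus "Poly_Mapping.lookup r p = Poly_Mapping.lookup (fext fbasis r) p"
          by (simp add: when_def sum.delta' in_keys_iff if_distrib cong: if_cong split: if_splits)
      qed
      hence "\<phi> r = \<phi> (fext fbasis r)" by simp
      thus ?thesis
        by (simp add: lin_ext_def \<phi>.sum \<phi>.scale split_def)
    qed
    ultimately have "\<phi> t = \<phi> u"
      using assms(3)[of ?f] by (simp add: tu ap2_cls2)
    thus False using \<phi>(3) by (simp add: \<phi>.diff)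
  qed
  thus ?thesis by (simp add: tu cls2_eq_iff)
qed

lemma tensor2_mem [simp]:
  "x \<otimes> y \<in> T2" "A \<oplus>\<^sub>2 B \<in> T2" "A \<ominus>\<^sub>2 B \<in> T2" "A \<odot>\<^sub>2 B \<in> T2" "flip A \<in> T2" "map2 g h A \<in> T2"
  by (simp_all add: T2_def tens2_def add2_def sub2_def mult2_def flip_def map2_def)

text \<open>These rules turn tensor operations into nested Sweedler sums. In an iterated operation a
  rule applies to the inner tensor only once the partially evaluated form is known to be bilinear,
  which is why the proofs below first collect \<open>form2\<close> facts.\<close>

lemma ap2_ops:
  assumes "form2 f"
  shows "ap2 f (x \<otimes> y) = f x y"
    and "ap2 f (A \<oplus>\<^sub>2 B) = ap2 f A + ap2 f B"
    and "ap2 f (A \<ominus>\<^sub>2 B) = ap2 f A - ap2 f B"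
    and "ap2 f (scale2 c A) = c * ap2 f A"
    and "ap2 f (A \<odot>\<^sub>2 B) = ap2 (\<lambda>x y. ap2 (\<lambda>u v. f (x * u) (y * v)) B) A"
    and "ap2 f (flip A) = ap2 (\<lambda>x y. f y x) A"
    and "ap2 f (map2 g h A) = ap2 (\<lambda>x y. f (g x) (h y)) A"
  using assms
  by (simp_all add: tens2_def add2_def sub2_def scale2_def mult2_def flip_def map2_def ap2_cls2
      fmult_def ground.lin_ext_add ground.lin_ext_diff ground.lin_ext_fscale ground.lin_ext_fext)
    (simp_all add: ap2_def split_def)

lemma ap3_ops:
  assumes "form3 f"
  shows "ap3 f (C \<oplus>\<^sub>3 D) = ap3 f C + ap3 f D"
    and "ap3 f (C \<odot>\<^sub>3 D) = ap3 (\<lambda>x y z. ap3 (\<lambda>u v w. f (x * u) (y * v) (z * w)) D) C"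
    and "ap3 f (leg12 A) = ap2 (\<lambda>x y. f x y 1) A"
    and "ap3 f (leg13 A) = ap2 (\<lambda>x y. f x 1 y) A"
    and "ap3 f (leg23 A) = ap2 (\<lambda>x y. f 1 x y) A"
    and "ap3 f (id_tensor g A) = ap2 (\<lambda>x y. ap2 (\<lambda>u v. f x u v) (g y)) A"
    and "ap3 f (tensor_id g A) = ap2 (\<lambda>x y. ap2 (\<lambda>u v. f u v y) (g x)) A"
  using assms
  by (simp_all add: add3_def mult3_def leg12_def leg13_def leg23_def id_tensor_def tensor_id_def
      ap3_cls3 fmult_def ground.lin_ext_add ground.lin_ext_fext)
    (simp_all add: ap3_def ap2_def split_def ground.lin_ext_fext)

lemma form1_ap3 [multilin]:
  assumes "\<And>x y w. form1 (\<lambda>z. g z x y w)"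
  shows "form1 (\<lambda>z. ap3 (\<lambda>x y w. g z x y w) C)"
  using assms by (simp add: form1_def ap3_def split_def ground.lin_ext_fun_add[symmetric]
      ground.lin_ext_fun_scale[symmetric])

text \<open>A functional commutes with the finite sum behind \<open>contract\<close>. This turns the
  counit and antipode axioms into identities between values of forms.\<close>

lemma ap2_contract:
  assumes "form1 \<phi>"
  shows "\<phi> (contract f A) = ap2 (\<lambda>x y. \<phi> (f x y)) A"
proof -
  have 0: "\<phi> 0 = 0" using assms unfolding form1_def by (metis add_cancel_right_right)
  have "\<phi> (\<Sum>i\<in>I. g i) = (\<Sum>i\<in>I. \<phi> (g i))" for g :: "'a \<times> 'a \<Rightarrow> 'a" and I
    by (induction I rule: infinite_finite_induct) (use assms 0 in \<open>auto simp: form1_def\<close>)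
  thus ?thesis
    using assms by (simp add: contract_def ap2_def lin_ext_def form1_def split_def)
qed

section \<open>The algebra structure of H \<otimes> H\<close>

lemma mult2_assoc: "A \<odot>\<^sub>2 B \<odot>\<^sub>2 C = A \<odot>\<^sub>2 (B \<odot>\<^sub>2 C)"
proof (rule tensor2_eqI)
  fix f :: "'a \<Rightarrow> 'a \<Rightarrow> 'k" assume f: "form2 f"
  note [multilin] = form2_comp[OF f]
  have "form2 (\<lambda>x y. ap2 (\<lambda>u v. f (x * u) (y * v)) C)" by (intro multilin)
  moreover have "form2 (\<lambda>u v. f (x * u) (y * v))" for x y by (intro multilin)
  ultimately show "ap2 f (A \<odot>\<^sub>2 B \<odot>\<^sub>2 C) = ap2 f (A \<odot>\<^sub>2 (B \<odot>\<^sub>2 C))"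
    using f by (simp add: ap2_ops mult.assoc)
qed simp_all

lemma mult2_one:
  assumes "A \<in> T2"
  shows "1 \<otimes> 1 \<odot>\<^sub>2 A = A" "A \<odot>\<^sub>2 (1 \<otimes> 1) = A"
proof -
  have "ap2 f (1 \<otimes> 1 \<odot>\<^sub>2 A) = ap2 f A \<and> ap2 f (A \<odot>\<^sub>2 (1 \<otimes> 1)) = ap2 f A" if f: "form2 f" for f
  proof -
    note [multilin] = form2_comp[OF f]
    have "form2 (\<lambda>x y. ap2 (\<lambda>u v. f (x * u) (y * v)) A)"
      "\<And>x y. form2 (\<lambda>u v. f (x * u) (y * v))" by (intro multilin)+
    with f show ?thesis by (simp add: ap2_ops)
  qed
  with assms show "1 \<otimes> 1 \<odot>\<^sub>2 A = A" "A \<odot>\<^sub>2 (1 \<otimes> 1) = A"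
    by (simp_all add: tensor2_eqI)
qed

text \<open>A left and a right inverse agree, as \<open>B = B (A B') = (B A) B' = B'\<close>. A
  tensor is thus identified with \<open>inv2 R\<close> by checking its product with \<open>R\<close>
  on one side.\<close>

lemma is_inverse2_unique:
  assumes "A \<in> T2" "B \<in> T2" "B' \<in> T2" "B \<odot>\<^sub>2 A = 1 \<otimes> 1" "A \<odot>\<^sub>2 B' = 1 \<otimes> 1"
  shows "B = B'"
  using assms by (metis mult2_assoc mult2_one)

lemma flip_flip: "A \<in> T2 \<Longrightarrow> flip (flip A) = A"
  by (rule tensor2_eqI) (auto simp: ap2_ops form2_def)

end


subsection \<open>Sweedler calculus in a Hopf algebra\<close>

context hopf_algebra
begin

lemma endo_antipode [multilin]: "endo g \<Longrightarrow> endo (\<lambda>x. S (g x))"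
proof -
  interpret S: Vector_Spaces.linear scale scale S by (rule antipode_linear)
  assume "endo g"
  thus ?thesis by (simp add: endo_def S.add S.scale)
qed

lemma form1_counit [multilin]: "endo g \<Longrightarrow> form1 (\<lambda>x. \<epsilon> (g x))"
proof -
  interpret \<epsilon>: Vector_Spaces.linear scale "(*)" \<epsilon> by (rule counit_linear)
  assume "endo g"
  thus ?thesis by (simp add: form1_def endo_def \<epsilon>.add \<epsilon>.scale)
qed

lemma form1_comult [multilin]:
  "form2 f \<Longrightarrow> endo g \<Longrightarrow> form1 (\<lambda>x. ap2 (\<lambda>u v. f u v) (\<Delta> (g x)))"
  by (simp add: form1_def endo_def comult_add comult_scale ap2_ops)

lemma ap2_coassoc:
  assumes "form3 f"
  shows "ap2 (\<lambda>x y. ap2 (\<lambda>u v. f u v y) (\<Delta> x)) (\<Delta> h) =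
    ap2 (\<lambda>x y. ap2 (\<lambda>u v. f x u v) (\<Delta> y)) (\<Delta> h)"
  using arg_cong[OF coassoc, of "ap3 f"] assms by (simp add: ap3_ops)

lemma ap2_counit:
  assumes "form1 \<phi>"
  shows "ap2 (\<lambda>x y. \<epsilon> x * \<phi> y) (\<Delta> h) = \<phi> h" "ap2 (\<lambda>x y. \<epsilon> y * \<phi> x) (\<Delta> h) = \<phi> h"
  using arg_cong[OF counit_left, of \<phi>] arg_cong[OF counit_right, of \<phi>] assms
  by (simp_all add: ap2_contract) (simp_all add: form1_def)

lemma ap2_antipode:
  assumes "form1 \<phi>"
  shows "ap2 (\<lambda>x y. \<phi> (S x * y)) (\<Delta> h) = \<epsilon> h * \<phi> 1"
    and "ap2 (\<lambda>x y. \<phi> (x * S y)) (\<Delta> h) = \<epsilon> h * \<phi> 1"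
  using arg_cong[OF antipode_left, of \<phi>] arg_cong[OF antipode_right, of \<phi>] assms
  by (simp_all add: ap2_contract) (simp_all add: form1_def)

lemma ap2_comult_mult:
  assumes "form2 f"
  shows "ap2 (\<lambda>x y. ap2 (\<lambda>u v. f (x * u) (y * v)) (\<Delta> h)) (\<Delta> g) = ap2 f (\<Delta> (g * h))"
  using assms by (simp add: comult_mult ap2_ops)

text \<open>Since \<open>\<Delta> 1 = 1 \<otimes> 1\<close>, the antipode axiom at 1 has a single
  term.\<close>

lemma antipode_one: "S 1 = 1"
proof (rule eq_if_forms_eq)
  fix \<phi> :: "'a \<Rightarrow> 'k" assume \<phi>: "form1 \<phi>"
  note [multilin] = form1_comp[OF \<phi>]
  have "form2 (\<lambda>x y. \<phi> (S x * y))" by (intro multilin)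
  thus "\<phi> (S 1) = \<phi> 1"
    using ap2_antipode(1)[OF \<phi>, of 1] by (simp add: comult_one ap2_ops counit_one)
qed

text \<open>Read from right to left, this inserts the cancelling factors
  \<open>h\<^sub>2 S(h\<^sub>3)\<close> from which the proof of \<open>antipode_mult\<close>
  starts.\<close>

lemma ap2_comult_antipode_right:
  assumes f: "form2 f"
  shows "ap2 (\<lambda>x y. ap2 (\<lambda>u v. f x (u * S v)) (\<Delta> y)) (\<Delta> h) = f h 1"
proof -
  note [multilin] = form2_comp[OF f]
  have "ap2 (\<lambda>u v. f x (u * S v)) (\<Delta> y) = \<epsilon> y * f x 1" for x y
    by (rule ap2_antipode(2)) (intro multilin)
  moreover have "ap2 (\<lambda>x y. \<epsilon> y * f x 1) (\<Delta> h) = f h 1"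
    by (rule ap2_counit(2)) (intro multilin)
  ultimately show ?thesis by simp
qed

text \<open>Both sides are obtained from \<open>S(g\<^sub>1 h\<^sub>1) g\<^sub>2 h\<^sub>2 S(h\<^sub>3) S(g\<^sub>3)\<close>, by cancelling from the
  right and from the left.\<close>

lemma antipode_mult: "S (g * h) = S h * S g"
proof (rule eq_if_forms_eq)
  fix \<phi> :: "'a \<Rightarrow> 'k" assume \<phi>: "form1 \<phi>"
  note [multilin] = form1_comp[OF \<phi>]
  have "\<phi> (S (g * h)) = ap2 (\<lambda>x y. ap2 (\<lambda>y1 y2. \<phi> (S (x * h) * (y1 * S y2))) (\<Delta> y)) (\<Delta> g)"
  proof -
    have "form2 (\<lambda>x z. \<phi> (S (x * h) * z))" by (intro multilin)
    from ap2_comult_antipode_right[OF this] show ?thesis by simp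
  qed
  also have "\<dots> = ap2 (\<lambda>x y. ap2 (\<lambda>y1 y2. ap2 (\<lambda>u v. ap2 (\<lambda>v1 v2.
      \<phi> (S (x * u) * (y1 * (v1 * S v2) * S y2))) (\<Delta> v)) (\<Delta> h)) (\<Delta> y)) (\<Delta> g)"
  proof -
    have "form2 (\<lambda>u w. \<phi> (S (x * u) * (y1 * w * S y2)))" for x y1 y2 by (intro multilin)
    from ap2_comult_antipode_right[OF this] show ?thesis by simp
  qed
  \<comment> \<open>Coassociativity regroups the legs of \<open>h\<close>, and in the next step
    those of \<open>g\<close>, so that the first two legs instead of the last two come from a common
    coproduct.\<close>
  also have "\<dots> = ap2 (\<lambda>x y. ap2 (\<lambda>y1 y2. ap2 (\<lambda>u v. ap2 (\<lambda>u1 u2.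
      \<phi> (S (x * u1) * (y1 * (u2 * S v) * S y2))) (\<Delta> u)) (\<Delta> h)) (\<Delta> y)) (\<Delta> g)"
  proof -
    have "form3 (\<lambda>u1 u2 v. \<phi> (S (x * u1) * (y1 * (u2 * S v) * S y2)))" for x y1 y2
      by (intro multilin)
    from ap2_coassoc[OF this] show ?thesis by simp
  qed
  also have "\<dots> = ap2 (\<lambda>x y. ap2 (\<lambda>x1 x2. ap2 (\<lambda>u v. ap2 (\<lambda>u1 u2.
      \<phi> (S (x1 * u1) * (x2 * (u2 * S v) * S y))) (\<Delta> u)) (\<Delta> h)) (\<Delta> x)) (\<Delta> g)"
  proof -
    have "form3 (\<lambda>x1 x2 y. ap2 (\<lambda>u v. ap2 (\<lambda>u1 u2.
        \<phi> (S (x1 * u1) * (x2 * (u2 * S v) * S y))) (\<Delta> u)) (\<Delta> h))"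
      by (intro multilin)
    from ap2_coassoc[OF this] show ?thesis by simp
  qed
  also have "\<dots> = ap2 (\<lambda>x y. ap2 (\<lambda>u v. ap2 (\<lambda>x1 x2. ap2 (\<lambda>u1 u2.
      \<phi> (S (x1 * u1) * (x2 * u2) * (S v * S y))) (\<Delta> u)) (\<Delta> x)) (\<Delta> h)) (\<Delta> g)"
    by (subst ap2_swap[of _ "\<Delta> h"]) (simp add: mult.assoc)
  also have "\<dots> = ap2 (\<lambda>x y. ap2 (\<lambda>u v. \<epsilon> x * (\<epsilon> u * \<phi> (S v * S y))) (\<Delta> h)) (\<Delta> g)"
  proof -
    \<comment> \<open>As \<Delta> is multiplicative, the double sum runs over the coproduct of
      \<open>x * u\<close>, and the antipode axiom for this product leaves
      \<open>\<epsilon> (x * u)\<close>.\<close>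
    have "ap2 (\<lambda>x1 x2. ap2 (\<lambda>u1 u2. \<phi> (S (x1 * u1) * (x2 * u2) * w)) (\<Delta> u)) (\<Delta> x) =
        \<epsilon> x * (\<epsilon> u * \<phi> w)" for x u w
    proof -
      have 1: "form2 (\<lambda>p q. \<phi> (S p * q * w))" and 2: "form1 (\<lambda>z. \<phi> (z * w))"
        by (intro multilin)+
      show ?thesis
        using ap2_comult_mult[OF 1, of u x] ap2_antipode(1)[OF 2, of "x * u"]
        by (simp add: counit_mult mult.assoc)
    qed
    thus ?thesis by simp
  qed
  also have "\<dots> = ap2 (\<lambda>x y. \<epsilon> x * \<phi> (S h * S y)) (\<Delta> g)"
  proof -
    have "form1 (\<lambda>v. \<phi> (S v * S y))" for y by (intro multilin)
    from ap2_counit(1)[OF this] show ?thesis by (simp add: ap2_cmult)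
  qed
  also have "\<dots> = \<phi> (S h * S g)"
    by (rule ap2_counit(1)) (intro multilin)
  finally show "\<phi> (S (g * h)) = \<phi> (S h * S g)" .
qed

text \<open>The map \<open>h \<mapsto> S(h\<^sub>2) \<otimes> S(h\<^sub>1)\<close> is a right
  convolution inverse of \<Delta>: in
  \<open>h\<^sub>1 S(h\<^sub>4) \<otimes> h\<^sub>2 S(h\<^sub>3)\<close> the inner pair of legs
  cancels first, then the outer pair.\<close>

lemma ap2_antipode_iterated:
  assumes g: "form2 g"
  shows "ap2 (\<lambda>x y. ap2 (\<lambda>u v. ap2 (\<lambda>w z. g (u * S z) (v * S w)) (\<Delta> y)) (\<Delta> x)) (\<Delta> h) =
    \<epsilon> h * g 1 1"
proof -
  note [multilin] = form2_comp[OF g]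
  have "form3 (\<lambda>u v y. ap2 (\<lambda>w z. g (u * S z) (v * S w)) (\<Delta> y))" by (intro multilin)
  hence "ap2 (\<lambda>x y. ap2 (\<lambda>u v. ap2 (\<lambda>w z. g (u * S z) (v * S w)) (\<Delta> y)) (\<Delta> x)) (\<Delta> h) =
      ap2 (\<lambda>u x. ap2 (\<lambda>v y. ap2 (\<lambda>w z. g (u * S z) (v * S w)) (\<Delta> y)) (\<Delta> x)) (\<Delta> h)"
    by (rule ap2_coassoc)
  also have "\<dots> = ap2 (\<lambda>u x. ap2 (\<lambda>y z. ap2 (\<lambda>v w. g (u * S z) (v * S w)) (\<Delta> y)) (\<Delta> x)) (\<Delta> h)"
  proof -
    have "form3 (\<lambda>v w z. g (u * S z) (v * S w))" for u by (intro multilin)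
    from ap2_coassoc[OF this] show ?thesis by simp
  qed
  also have "\<dots> = ap2 (\<lambda>u x. ap2 (\<lambda>y z. \<epsilon> y * g (u * S z) 1) (\<Delta> x)) (\<Delta> h)"
  proof -
    have "form1 (\<lambda>t. g r t)" for r by (intro multilin)
    from ap2_antipode(2)[OF this] show ?thesis by simp
  qed
  also have "\<dots> = ap2 (\<lambda>u x. g (u * S x) 1) (\<Delta> h)"
  proof -
    have "form1 (\<lambda>z. g (u * S z) 1)" for u by (intro multilin)
    from ap2_counit(1)[OF this] show ?thesis by simp
  qed
  also have "\<dots> = \<epsilon> h * g 1 1"
  proof -
    have "form1 (\<lambda>t. g t 1)" by (intro multilin)
    from ap2_antipode(2)[OF this] show ?thesis .
  qed
  finally show ?thesis .
qed

text \<open>Again two cancellations, now in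
  \<open>\<Delta>(S(h\<^sub>1)) (h\<^sub>2 \<otimes> h\<^sub>3) (S(h\<^sub>5) \<otimes> S(h\<^sub>4))\<close>.\<close>

lemma comult_antipode: "\<Delta> (S h) = flip (map2 S S (\<Delta> h))"
proof (rule tensor2_eqI)
  fix f :: "'a \<Rightarrow> 'a \<Rightarrow> 'k" assume f: "form2 f"
  note [multilin] = form2_comp[OF f]
  \<comment> \<open>The counit factor split off here is expanded in the next step by
    \<open>ap2_antipode_iterated\<close>.\<close>
  have "ap2 f (\<Delta> (S h)) = ap2 (\<lambda>x y. \<epsilon> y * ap2 f (\<Delta> (S x))) (\<Delta> h)"
  proof -
    have "form1 (\<lambda>x. ap2 (\<lambda>u v. f u v) (\<Delta> (S x)))" by (intro multilin)
    from ap2_counit(2)[OF this] show ?thesis by simp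
  qed
  also have "\<dots> = ap2 (\<lambda>x y. ap2 (\<lambda>p q. ap2 (\<lambda>r s. ap2 (\<lambda>u v. ap2 (\<lambda>w z.
      f (p * (u * S z)) (q * (v * S w))) (\<Delta> s)) (\<Delta> r)) (\<Delta> y)) (\<Delta> (S x))) (\<Delta> h)"
  proof -
    have "form2 (\<lambda>a b. f (p * a) (q * b))" for p q by (intro multilin)
    from ap2_antipode_iterated[OF this] show ?thesis by (simp add: ap2_cmult)
  qed
  also have "\<dots> = ap2 (\<lambda>x y. ap2 (\<lambda>r s. ap2 (\<lambda>p q. ap2 (\<lambda>u v. ap2 (\<lambda>w z.
      f (p * (u * S z)) (q * (v * S w))) (\<Delta> s)) (\<Delta> r)) (\<Delta> (S x))) (\<Delta> y)) (\<Delta> h)"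
    by (subst ap2_swap) (rule refl)
  also have "\<dots> = ap2 (\<lambda>x y. ap2 (\<lambda>x1 x2. ap2 (\<lambda>p q. ap2 (\<lambda>u v. ap2 (\<lambda>w z.
      f (p * (u * S z)) (q * (v * S w))) (\<Delta> y)) (\<Delta> x2)) (\<Delta> (S x1))) (\<Delta> x)) (\<Delta> h)"
  proof -
    have "form3 (\<lambda>x r s. ap2 (\<lambda>p q. ap2 (\<lambda>u v. ap2 (\<lambda>w z.
        f (p * (u * S z)) (q * (v * S w))) (\<Delta> s)) (\<Delta> r)) (\<Delta> (S x)))"
      by (intro multilin)
    from ap2_coassoc[OF this] show ?thesis by simp
  qed
  also have "\<dots> = ap2 (\<lambda>x y. \<epsilon> x * ap2 (\<lambda>w z. f (S z) (S w)) (\<Delta> y)) (\<Delta> h)"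
  proof -
    \<comment> \<open>The composite of \<Delta> after \<open>S\<close> is a left convolution inverse
      of \<Delta>, because \<open>\<Delta>(S(x\<^sub>1)) \<Delta>(x\<^sub>2) = \<Delta>(S(x\<^sub>1)
      x\<^sub>2)\<close>. The lemma is thus uniqueness of convolution inverses, written out.\<close>
    have cancel: "ap2 (\<lambda>x1 x2. ap2 (\<lambda>p q. ap2 (\<lambda>u v. g (p * u) (q * v)) (\<Delta> x2)) (\<Delta> (S x1))) (\<Delta> x) =
        \<epsilon> x * g 1 1" if g: "form2 g" for g x
    proof -
      note [multilin] = form2_comp[OF g]
      have "form1 (\<lambda>t. ap2 (\<lambda>u v. g u v) (\<Delta> t))" by (intro multilin)
      from ap2_antipode(1)[OF this, of x] show ?thesis
        using g by (simp add: ap2_comult_mult comult_one ap2_ops)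
    qed
    have "form2 (\<lambda>a b. ap2 (\<lambda>w z. f (a * S z) (b * S w)) (\<Delta> y))" for y
      by (intro multilin)
    from cancel[OF this] show ?thesis
      by (simp add: mult.assoc)
  qed
  also have "\<dots> = ap2 (\<lambda>w z. f (S z) (S w)) (\<Delta> h)"
    by (rule ap2_counit(1)) (intro multilin)
  also have "\<dots> = ap2 f (flip (map2 S S (\<Delta> h)))"
  proof -
    have "form2 (\<lambda>x y. f y x)" by (intro multilin)
    with f show ?thesis by (simp add: ap2_ops)
  qed
  finally show "ap2 f (\<Delta> (S h)) = ap2 f (flip (map2 S S (\<Delta> h)))" .
qed (simp_all add: comult_mem)

lemma map2_antipode_mult:
  "map2 S S (A \<odot>\<^sub>2 B) = map2 S S B \<odot>\<^sub>2 map2 S S A"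
proof (rule tensor2_eqI)
  fix f :: "'a \<Rightarrow> 'a \<Rightarrow> 'k" assume f: "form2 f"
  note [multilin] = form2_comp[OF f]
  have "form2 (\<lambda>x y. f (S x) (S y))" "\<And>x y. form2 (\<lambda>u v. f (x * u) (y * v))"
    "form2 (\<lambda>x y. ap2 (\<lambda>u v. f (x * u) (y * v)) (map2 S S A))" by (intro multilin)+
  thus "ap2 f (map2 S S (A \<odot>\<^sub>2 B)) = ap2 f (map2 S S B \<odot>\<^sub>2 map2 S S A)"
    using f by (simp add: ap2_ops antipode_mult ap2_swap[of _ B A])
qed simp_all

lemma map2_antipode_one: "map2 S S (1 \<otimes> 1) = 1 \<otimes> 1"
proof (rule tensor2_eqI)
  fix f :: "'a \<Rightarrow> 'a \<Rightarrow> 'k" assume f: "form2 f"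
  note [multilin] = form2_comp[OF f]
  have "form2 (\<lambda>x y. f (S x) (S y))" by (intro multilin)
  with f show "ap2 f (map2 S S (1 \<otimes> 1)) = ap2 f (1 \<otimes> 1)"
    by (simp add: ap2_ops antipode_one)
qed simp_all

end

subsection \<open>The antipode on a quasitriangular structure\<close>

context quasitriangular_hopf_algebra
begin

lemma R_mem [simp]: "R \<in> T2"
  using R_invertible by (simp add: invertible2_def)

text \<open>\<open>inv2\<close> is a definite description, so existence of an inverse has to be
  joined with uniqueness.\<close>

lemma is_inverse2_inv2_R: "is_inverse2 R (inv2 R)"
proof -
  obtain B where B: "is_inverse2 R B"
    using R_invertible by (auto simp: invertible2_def)
  moreover have "B' = B" if "is_inverse2 R B'" for B'
    using that B by (intro is_inverse2_unique[of R B' B]) (simp_all add: is_inverse2_def)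
  ultimately show ?thesis
    unfolding inv2_def by (rule theI)
qed

lemma inv2_R_mem [simp]: "inv2 R \<in> T2"
  and R_inv2: "R \<odot>\<^sub>2 inv2 R = 1 \<otimes> 1"
  and inv2_R: "inv2 R \<odot>\<^sub>2 R = 1 \<otimes> 1"
  using is_inverse2_inv2_R by (simp_all add: is_inverse2_def)

lemma ap2_R_inv2:
  assumes "form2 f"
  shows "ap2 (\<lambda>x y. ap2 (\<lambda>u v. f (x * u) (y * v)) (inv2 R)) R = f 1 1"
    and "ap2 (\<lambda>x y. ap2 (\<lambda>u v. f (x * u) (y * v)) R) (inv2 R) = f 1 1"
  using arg_cong[OF R_inv2, of "ap2 f"] arg_cong[OF inv2_R, of "ap2 f"] assms
  by (simp_all add: ap2_ops)

lemma ap2_R_comult: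
  assumes f: "form3 f"
  shows "ap2 (\<lambda>x y. ap2 (\<lambda>u v. f u v y) (\<Delta> x)) R = ap2 (\<lambda>x y. ap2 (\<lambda>u v. f x u (y * v)) R) R"
    and "ap2 (\<lambda>x y. ap2 (\<lambda>u v. f x u v) (\<Delta> y)) R = ap2 (\<lambda>x y. ap2 (\<lambda>u v. f (x * u) v y) R) R"
proof -
  note [multilin] = form3_comp[OF f]
  have [simp]: "form3 (\<lambda>u v w. f (x * u) (y * v) (z * w))" for x y z
    by (intro multilin)
  have [simp]: "form3 (\<lambda>x y z. ap2 (\<lambda>u v. f x (y * u) (z * v)) R)"
    "form3 (\<lambda>x y z. ap2 (\<lambda>u v. f (x * u) (y * v) z) R)"
    by (intro multilin)+
  show "ap2 (\<lambda>x y. ap2 (\<lambda>u v. f u v y) (\<Delta> x)) R = ap2 (\<lambda>x y. ap2 (\<lambda>u v. f x u (y * v)) R) R"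
    using arg_cong[OF R_comult_id, of "ap3 f"] f by (simp add: ap3_ops)
  show "ap2 (\<lambda>x y. ap2 (\<lambda>u v. f x u v) (\<Delta> y)) R = ap2 (\<lambda>x y. ap2 (\<lambda>u v. f (x * u) v y) R) R"
    using arg_cong[OF R_id_comult, of "ap3 f"] f by (simp add: ap3_ops)
qed

text \<open>\<open>(\<epsilon> \<otimes> Id)(R)\<close> is invertible and, by the hexagon axiom, idempotent.\<close>

lemma ap2_R_counit_left:
  assumes \<phi>: "form1 \<phi>"
  shows "ap2 (\<lambda>x y. \<epsilon> x * \<phi> y) R = \<phi> 1" "ap2 (\<lambda>x y. \<epsilon> x * \<phi> y) (inv2 R) = \<phi> 1"
proof -
  define r where "r = contract (\<lambda>x y. \<epsilon> x *s y) R"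
  define r' where "r' = contract (\<lambda>x y. \<epsilon> x *s y) (inv2 R)"
  have r: "\<psi> r = ap2 (\<lambda>x y. \<epsilon> x * \<psi> y) R" "\<psi> r' = ap2 (\<lambda>x y. \<epsilon> x * \<psi> y) (inv2 R)"
    if "form1 \<psi>" for \<psi>
    using that unfolding r_def r'_def by (simp_all add: ap2_contract, simp_all add: form1_def)
  have rr: "r * r = r"
  proof (rule eq_if_forms_eq)
    fix \<psi> :: "'a \<Rightarrow> 'k" assume \<psi>: "form1 \<psi>"
    note [multilin] = form1_comp[OF \<psi>]
    \<comment> \<open>This form applies \<epsilon> to the first two legs. On the hexagon axiom for
      \<Delta> \<otimes> Id it produces \<open>r * r\<close> on one side and \<open>r\<close> on the
      other.\<close>
    have f: "form3 (\<lambda>x y z. \<epsilon> x * (\<epsilon> y * \<psi> z))" and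
      h: "form1 (\<lambda>z. \<psi> (z * r))" "\<And>y. form1 (\<lambda>z. \<psi> (y * z))"
      by (intro multilin)+
    have "\<psi> (r * r) = ap2 (\<lambda>x y. ap2 (\<lambda>u v. \<epsilon> x * (\<epsilon> u * \<psi> (y * v))) R) R"
      using r(1)[OF h(1)] r(1)[OF h(2)] by (simp add: ap2_cmult)
    also have "\<dots> = ap2 (\<lambda>x y. ap2 (\<lambda>u v. \<epsilon> u * (\<epsilon> v * \<psi> y)) (\<Delta> x)) R"
      by (rule ap2_R_comult(1)[OF f, symmetric])
    also have "\<dots> = ap2 (\<lambda>x y. \<epsilon> x * \<psi> y) R"
    proof -
      have "form1 (\<lambda>v. \<epsilon> v * \<psi> y)" for y by (intro multilin)
      from ap2_counit(1)[OF this] show ?thesis by simp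
    qed
    finally show "\<psi> (r * r) = \<psi> r" using r(1)[OF \<psi>] by simp
  qed
  have rr': "r * r' = 1"
  proof (rule eq_if_forms_eq)
    fix \<psi> :: "'a \<Rightarrow> 'k" assume \<psi>: "form1 \<psi>"
    note [multilin] = form1_comp[OF \<psi>]
    have f: "form2 (\<lambda>x z. \<epsilon> x * \<psi> z)" and
      h: "form1 (\<lambda>z. \<psi> (z * r'))" "\<And>y. form1 (\<lambda>z. \<psi> (y * z))"
      by (intro multilin)+
    have "\<psi> (r * r') = ap2 (\<lambda>x y. ap2 (\<lambda>u v. \<epsilon> (x * u) * \<psi> (y * v)) (inv2 R)) R"
      using r(1)[OF h(1)] r(2)[OF h(2)] by (simp add: ap2_cmult counit_mult mult.assoc)
    thus "\<psi> (r * r') = \<psi> 1"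
      using ap2_R_inv2(1)[OF f] by (simp add: counit_one)
  qed
  have "r = r * r * r'" by (simp add: mult.assoc rr')
  also have "\<dots> = 1" by (simp add: rr rr')
  finally have "r = 1" .
  with rr' have "r' = 1" by simp
  show "ap2 (\<lambda>x y. \<epsilon> x * \<phi> y) R = \<phi> 1" "ap2 (\<lambda>x y. \<epsilon> x * \<phi> y) (inv2 R) = \<phi> 1"
    using r[OF \<phi>] \<open>r = 1\<close> \<open>r' = 1\<close> by simp_all
qed

text \<open>Mirror image of the preceding lemma, with the hexagon axiom for Id \<otimes>
  \<Delta>.\<close>

lemma ap2_R_counit_right:
  assumes \<phi>: "form1 \<phi>"
  shows "ap2 (\<lambda>x y. \<epsilon> y * \<phi> x) R = \<phi> 1" "ap2 (\<lambda>x y. \<epsilon> y * \<phi> x) (inv2 R) = \<phi> 1"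
proof -
  define r where "r = contract (\<lambda>x y. \<epsilon> y *s x) R"
  define r' where "r' = contract (\<lambda>x y. \<epsilon> y *s x) (inv2 R)"
  have r: "\<psi> r = ap2 (\<lambda>x y. \<epsilon> y * \<psi> x) R" "\<psi> r' = ap2 (\<lambda>x y. \<epsilon> y * \<psi> x) (inv2 R)"
    if "form1 \<psi>" for \<psi>
    using that unfolding r_def r'_def by (simp_all add: ap2_contract, simp_all add: form1_def)
  have rr: "r * r = r"
  proof (rule eq_if_forms_eq)
    fix \<psi> :: "'a \<Rightarrow> 'k" assume \<psi>: "form1 \<psi>"
    note [multilin] = form1_comp[OF \<psi>]
    have f: "form3 (\<lambda>x y z. \<epsilon> z * (\<epsilon> y * \<psi> x))" and
      h: "form1 (\<lambda>z. \<psi> (z * r))" "\<And>y. form1 (\<lambda>z. \<psi> (y * z))"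
      by (intro multilin)+
    have "\<psi> (r * r) = ap2 (\<lambda>x y. ap2 (\<lambda>u v. \<epsilon> y * (\<epsilon> v * \<psi> (x * u))) R) R"
      using r(1)[OF h(1)] r(1)[OF h(2)] by (simp add: ap2_cmult)
    also have "\<dots> = ap2 (\<lambda>x y. ap2 (\<lambda>u v. \<epsilon> v * (\<epsilon> u * \<psi> x)) (\<Delta> y)) R"
      by (rule ap2_R_comult(2)[OF f, symmetric])
    also have "\<dots> = ap2 (\<lambda>x y. \<epsilon> y * \<psi> x) R"
    proof -
      have "form1 (\<lambda>v. \<epsilon> v * \<psi> y)" for y by (intro multilin)
      from ap2_counit(2)[OF this] show ?thesis by simp
    qed
    finally show "\<psi> (r * r) = \<psi> r" using r(1)[OF \<psi>] by simp
  qed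
  have rr': "r * r' = 1"
  proof (rule eq_if_forms_eq)
    fix \<psi> :: "'a \<Rightarrow> 'k" assume \<psi>: "form1 \<psi>"
    note [multilin] = form1_comp[OF \<psi>]
    have f: "form2 (\<lambda>x z. \<epsilon> z * \<psi> x)" and
      h: "form1 (\<lambda>z. \<psi> (z * r'))" "\<And>y. form1 (\<lambda>z. \<psi> (y * z))"
      by (intro multilin)+
    have "\<psi> (r * r') = ap2 (\<lambda>x y. ap2 (\<lambda>u v. \<epsilon> (y * v) * \<psi> (x * u)) (inv2 R)) R"
      using r(1)[OF h(1)] r(2)[OF h(2)] by (simp add: ap2_cmult counit_mult mult.assoc)
    thus "\<psi> (r * r') = \<psi> 1"
      using ap2_R_inv2(1)[OF f] by (simp add: counit_one)
  qed
  have "r = r * r * r'" by (simp add: mult.assoc rr')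
  also have "\<dots> = 1" by (simp add: rr rr')
  finally have "r = 1" .
  with rr' have "r' = 1" by simp
  show "ap2 (\<lambda>x y. \<epsilon> y * \<phi> x) R = \<phi> 1" "ap2 (\<lambda>x y. \<epsilon> y * \<phi> x) (inv2 R) = \<phi> 1"
    using r[OF \<phi>] \<open>r = 1\<close> \<open>r' = 1\<close> by simp_all
qed

text \<open>Applying \<open>S x * y\<close> to the first two legs of
  \<open>R\<^sub>1\<^sub>3 R\<^sub>2\<^sub>3\<close> gives (S \<otimes> Id)(R) R. By the hexagon
  axiom these two legs are a coproduct, so the antipode and the counit reduce the product to 1
  \<otimes> 1.\<close>

lemma map2_antipode_id_R: "map2 S (\<lambda>x. x) R = inv2 R"
proof (rule is_inverse2_unique[of R])
  show "map2 S (\<lambda>x. x) R \<odot>\<^sub>2 R = 1 \<otimes> 1"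
  proof (rule tensor2_eqI)
    fix f :: "'a \<Rightarrow> 'a \<Rightarrow> 'k" assume f: "form2 f"
    note [multilin] = form2_comp[OF f]
    have [simp]: "form2 (\<lambda>x y. ap2 (\<lambda>u v. f (x * u) (y * v)) R)" by (intro multilin)
    have g: "form3 (\<lambda>x y z. f (S x * y) z)" by (intro multilin)
    have "ap2 f (map2 S (\<lambda>x. x) R \<odot>\<^sub>2 R) = ap2 (\<lambda>x y. ap2 (\<lambda>u v. f (S x * u) (y * v)) R) R"
      using f by (simp add: ap2_ops)
    also have "\<dots> = ap2 (\<lambda>x y. ap2 (\<lambda>u v. f (S u * v) y) (\<Delta> x)) R"
      by (rule ap2_R_comult(1)[OF g, symmetric])
    also have "\<dots> = ap2 (\<lambda>x y. \<epsilon> x * f 1 y) R"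
    proof -
      have "form1 (\<lambda>z. f z y)" for y by (intro multilin)
      from ap2_antipode(1)[OF this] show ?thesis by simp
    qed
    also have "\<dots> = f 1 1"
      by (rule ap2_R_counit_left(1)) (intro multilin)
    finally show "ap2 f (map2 S (\<lambda>x. x) R \<odot>\<^sub>2 R) = ap2 f (1 \<otimes> 1)"
      using f by (simp add: ap2_ops)
  qed simp_all
qed (simp_all add: R_inv2)

lemma ap2_inv2_R: "form2 f \<Longrightarrow> ap2 f (inv2 R) = ap2 (\<lambda>x y. f (S x) y) R"
  by (simp add: map2_antipode_id_R[symmetric] ap2_ops)

text \<open>Writing the inverse of \<open>R\<close> as (S \<otimes> Id)(R) and using that
  \<open>S\<close> reverses products, (S \<otimes> S)(R) times this inverse arises from
  \<open>R\<^sub>1\<^sub>3 R\<^sub>1\<^sub>2\<close> by applying \<open>S\<close> to the first leg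
  and \<open>S y * z\<close> to the others. The other hexagon axiom collapses it.\<close>

lemma map2_antipode_R: "map2 S S R = R"
proof (rule is_inverse2_unique[of "inv2 R"])
  show "map2 S S R \<odot>\<^sub>2 inv2 R = 1 \<otimes> 1"
  proof (rule tensor2_eqI)
    fix f :: "'a \<Rightarrow> 'a \<Rightarrow> 'k" assume f: "form2 f"
    note [multilin] = form2_comp[OF f]
    have [simp]: "form2 (\<lambda>x y. ap2 (\<lambda>u v. f (x * u) (y * v)) (inv2 R))"
      "form2 (\<lambda>x y. ap2 (\<lambda>u v. f (x * S u) (y * v)) R)"
      "form2 (\<lambda>u v. f (x * u) (y * v))" for x y by (intro multilin)+
    have g: "form3 (\<lambda>x y z. f (S x) (S y * z))" by (intro multilin)
    have "ap2 f (map2 S S R \<odot>\<^sub>2 inv2 R) = ap2 (\<lambda>x y. ap2 (\<lambda>u v. f (S (u * x)) (S y * v)) R) R"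
      using f by (simp add: ap2_ops ap2_inv2_R antipode_mult)
    also have "\<dots> = ap2 (\<lambda>x y. ap2 (\<lambda>u v. f (S (x * u)) (S v * y)) R) R"
      by (rule ap2_swap)
    also have "\<dots> = ap2 (\<lambda>x y. ap2 (\<lambda>u v. f (S x) (S u * v)) (\<Delta> y)) R"
      by (rule ap2_R_comult(2)[OF g, symmetric])
    also have "\<dots> = ap2 (\<lambda>x y. \<epsilon> y * f (S x) 1) R"
    proof -
      have "form1 (\<lambda>z. f (S x) z)" for x by (intro multilin)
      from ap2_antipode(1)[OF this] show ?thesis by simp
    qed
    also have "\<dots> = f (S 1) 1"
      by (rule ap2_R_counit_right(1)) (intro multilin)
    finally show "ap2 f (map2 S S R \<odot>\<^sub>2 inv2 R) = ap2 f (1 \<otimes> 1)"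
      using f by (simp add: ap2_ops antipode_one)
  qed simp_all
qed (simp_all add: inv2_R)

lemma map2_antipode_inv2_R: "map2 S S (inv2 R) = inv2 R"
proof (rule is_inverse2_unique[of R])
  have "map2 S S (inv2 R) \<odot>\<^sub>2 map2 S S R = map2 S S (R \<odot>\<^sub>2 inv2 R)"
    by (simp add: map2_antipode_mult)
  thus "map2 S S (inv2 R) \<odot>\<^sub>2 R = 1 \<otimes> 1"
    by (simp add: map2_antipode_R R_inv2 map2_antipode_one)
qed (simp_all add: R_inv2)

lemma ap2_antipode_R:
  assumes "form2 f"
  shows "ap2 (\<lambda>x y. f (S x) (S y)) R = ap2 f R"
    and "ap2 (\<lambda>x y. f (S x) (S y)) (inv2 R) = ap2 f (inv2 R)"
  using ap2_ops(7)[OF assms, of S S] by (metis map2_antipode_R map2_antipode_inv2_R)+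

end

subsection \<open>The antipode on an infinitesimal R-matrix\<close>

context pre_cartier
begin

lemma ap2_chi_comult:
  assumes f: "form3 f"
  shows "ap2 (\<lambda>x y. ap2 (\<lambda>u v. f u v y) (\<Delta> x)) \<chi> = ap2 (\<lambda>x y. f 1 x y) \<chi> +
      ap2 (\<lambda>u v. ap2 (\<lambda>x y. ap2 (\<lambda>p q. f x (u * p) (v * y * q)) R) \<chi>) (inv2 R)"
    and "ap2 (\<lambda>x y. ap2 (\<lambda>u v. f x u v) (\<Delta> y)) \<chi> = ap2 (\<lambda>x y. f x y 1) \<chi> +
      ap2 (\<lambda>u v. ap2 (\<lambda>x y. ap2 (\<lambda>p q. f (u * x * p) (v * q) y) R) \<chi>) (inv2 R)"
proof -
  note [multilin] = form3_comp[OF f]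
  have fst_prod: "form3 (\<lambda>x y z. ap3 (\<lambda>u v w. f (x * u) (y * v) (z * w)) C)" for C
    by (intro multilin)
  have triple: "ap3 f (A \<odot>\<^sub>3 B \<odot>\<^sub>3 C) = ap3 (\<lambda>x y z. ap3 (\<lambda>u v w. ap3 (\<lambda>u' v' w'.
      f (x * u * u') (y * v * v') (z * w * w')) C) B) A" for A B C
    using ap3_ops(2)[OF f] ap3_ops(2)[OF fst_prod] by simp
  have third: "form3 (\<lambda>u' v' w'. f (x * u * u') (y * v * v') (z * w * w'))" for x y z u v w
    by (intro multilin)
  \<comment> \<open>\<open>snd23\<close> and \<open>snd12\<close> are the forms that meet the second
    factor, \<open>fst23\<close> and \<open>fst12\<close> those that meet the first, once the
    factors to the right have been expanded.\<close>
  have fst23: "form3 (\<lambda>x y z. ap2 (\<lambda>u v. ap2 (\<lambda>p q. f (x * u * 1) (y * 1 * p) (z * v * q)) R) \<chi>)"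
    and snd23: "form3 (\<lambda>u v w. ap2 (\<lambda>p q. f (x * u * 1) (y * v * p) (z * w * q)) R)"
    and fst12: "form3 (\<lambda>x y z. ap2 (\<lambda>u v. ap2 (\<lambda>p q. f (x * u * p) (y * 1 * q) (z * v * 1)) R) \<chi>)"
    and snd12: "form3 (\<lambda>u v w. ap2 (\<lambda>p q. f (x * u * p) (y * v * q) (z * w * 1)) R)" for x y z
    by (intro multilin)+
  have "ap3 f (leg23 (inv2 R) \<odot>\<^sub>3 leg13 \<chi> \<odot>\<^sub>3 leg23 R) =
      ap2 (\<lambda>u v. ap2 (\<lambda>x y. ap2 (\<lambda>p q. f x (u * p) (v * y * q)) R) \<chi>) (inv2 R)"
    by (simp only: triple ap3_ops(5)[OF third] ap3_ops(5)[OF fst23] ap3_ops(4)[OF snd23])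
      (simp only: mult_1_left mult_1_right)
  thus "ap2 (\<lambda>x y. ap2 (\<lambda>u v. f u v y) (\<Delta> x)) \<chi> = ap2 (\<lambda>x y. f 1 x y) \<chi> +
      ap2 (\<lambda>u v. ap2 (\<lambda>x y. ap2 (\<lambda>p q. f x (u * p) (v * y * q)) R) \<chi>) (inv2 R)"
    using arg_cong[OF chi_comult_id, of "ap3 f"] ap3_ops(1,5,7)[OF f] by simp
  have "ap3 f (leg12 (inv2 R) \<odot>\<^sub>3 leg13 \<chi> \<odot>\<^sub>3 leg12 R) =
      ap2 (\<lambda>u v. ap2 (\<lambda>x y. ap2 (\<lambda>p q. f (u * x * p) (v * q) y) R) \<chi>) (inv2 R)"
    by (simp only: triple ap3_ops(3)[OF third] ap3_ops(3)[OF fst12] ap3_ops(4)[OF snd12])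
      (simp only: mult_1_left mult_1_right)
  thus "ap2 (\<lambda>x y. ap2 (\<lambda>u v. f x u v) (\<Delta> y)) \<chi> = ap2 (\<lambda>x y. f x y 1) \<chi> +
      ap2 (\<lambda>u v. ap2 (\<lambda>x y. ap2 (\<lambda>p q. f (u * x * p) (v * q) y) R) \<chi>) (inv2 R)"
    using arg_cong[OF chi_id_comult, of "ap3 f"] ap3_ops(1,3,6)[OF f] by simp
qed

text \<open>Under \<epsilon> applied to both legs of the coproduct, the conjugating copies of
  \<open>R\<close> disappear and the hexagon axiom for \<chi> takes the form
  \<open>c = c + c\<close>.\<close>

lemma ap2_chi_counit:
  assumes \<phi>: "form1 \<phi>"
  shows "ap2 (\<lambda>x y. \<epsilon> x * \<phi> y) \<chi> = 0" "ap2 (\<lambda>x y. \<epsilon> y * \<phi> x) \<chi> = 0"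
proof -
  note [multilin] = form1_comp[OF \<phi>]
  have counit: "ap2 (\<lambda>u v. \<epsilon> u * (\<epsilon> v * c)) (\<Delta> x) = \<epsilon> x * c" for c x
  proof -
    have "form1 (\<lambda>v. \<epsilon> v * c)" by (intro multilin)
    from ap2_counit(1)[OF this] show ?thesis .
  qed
  have "ap2 (\<lambda>x y. \<epsilon> x * \<phi> y) \<chi> = ap2 (\<lambda>x y. \<epsilon> x * \<phi> y) \<chi> + ap2 (\<lambda>x y. \<epsilon> x * \<phi> y) \<chi>"
  proof -
    have f: "form3 (\<lambda>x y z. \<epsilon> x * (\<epsilon> y * \<phi> z))" by (intro multilin)
    have 1: "form1 (\<lambda>q. \<phi> (v * (y * q)))" for v y by (intro multilin)
    have 2: "form1 (\<lambda>v. ap2 (\<lambda>x y. \<epsilon> x * \<phi> (v * y)) \<chi>)" by (intro multilin)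
    have "ap2 (\<lambda>u v. ap2 (\<lambda>x y. ap2 (\<lambda>p q. \<epsilon> x * (\<epsilon> (u * p) * \<phi> (v * y * q))) R) \<chi>) (inv2 R) =
        ap2 (\<lambda>u v. \<epsilon> u * ap2 (\<lambda>x y. \<epsilon> x * \<phi> (v * y)) \<chi>) (inv2 R)"
      by (simp add: counit_mult ap2_cmult mult.assoc mult.left_commute[of "\<epsilon> _" "\<epsilon> u" for u]
          ap2_R_counit_left(1)[OF 1])
    with ap2_chi_comult(1)[OF f] show ?thesis
      by (simp add: counit counit_one ap2_R_counit_left(2)[OF 2])
  qed
  thus "ap2 (\<lambda>x y. \<epsilon> x * \<phi> y) \<chi> = 0" by (metis add_cancel_right_right)
  have "ap2 (\<lambda>x y. \<epsilon> y * \<phi> x) \<chi> = ap2 (\<lambda>x y. \<epsilon> y * \<phi> x) \<chi> + ap2 (\<lambda>x y. \<epsilon> y * \<phi> x) \<chi>"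
  proof -
    have f: "form3 (\<lambda>x y z. \<epsilon> y * (\<epsilon> z * \<phi> x))" by (intro multilin)
    have 1: "form1 (\<lambda>q. \<phi> (v * (y * q)))" for v y by (intro multilin)
    have 2: "form1 (\<lambda>v. ap2 (\<lambda>x y. \<epsilon> y * \<phi> (v * x)) \<chi>)" by (intro multilin)
    have "ap2 (\<lambda>u v. ap2 (\<lambda>x y. ap2 (\<lambda>p q. \<epsilon> (v * q) * (\<epsilon> y * \<phi> (u * x * p))) R) \<chi>) (inv2 R) =
        ap2 (\<lambda>u v. \<epsilon> v * ap2 (\<lambda>x y. \<epsilon> y * \<phi> (u * x)) \<chi>) (inv2 R)"
      by (simp add: counit_mult ap2_cmult mult.assoc mult.left_commute[of "\<epsilon> _" "\<epsilon> y" for y]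
          ap2_R_counit_right(1)[OF 1])
    with ap2_chi_comult(2)[OF f] show ?thesis
      by (simp add: counit counit_one ap2_R_counit_right(2)[OF 2])
  qed
  thus "ap2 (\<lambda>x y. \<epsilon> y * \<phi> x) \<chi> = 0" by (metis add_cancel_right_right)
qed

text \<open>Contracting the two hexagon axioms with the antipode expresses both \<open>\<chi>\<close> and
  \<open>(S \<otimes> S)(\<chi>)\<close> through the tensor \<open>M = S(\<chi>\<^sup>j) R'\<^sup>i \<otimes> R'\<^sub>i \<chi>\<^sub>j\<close> with \<open>R'\<close> the inverse of \<open>R\<close>:
  \<open>\<chi> = - M R\<close> and \<open>(S \<otimes> S)(\<chi>) = - R M\<close>.\<close>

lemma ap2_chi_antipode_left:
  assumes f: "form2 f"
  shows "ap2 f \<chi> = - ap2 (\<lambda>x y. ap2 (\<lambda>u v. ap2 (\<lambda>p q. f (S x * u * p) (v * y * q)) R) (inv2 R)) \<chi>"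
proof -
  note [multilin] = form2_comp[OF f]
  \<comment> \<open>With this form the legs of the coproduct collapse to \<epsilon>, so the left
    side of the hexagon axiom vanishes on \<chi>, while the first summand on the right returns
    \<chi> itself.\<close>
  have g: "form3 (\<lambda>x y z. f (S x * y) z)" by (intro multilin)
  have "ap2 (\<lambda>u v. f (S u * v) y) (\<Delta> x) = \<epsilon> x * f 1 y" for x y
    by (rule ap2_antipode(1)) (intro multilin)
  moreover have "ap2 (\<lambda>x y. \<epsilon> x * f 1 y) \<chi> = 0"
    by (rule ap2_chi_counit(1)) (intro multilin)
  ultimately have "ap2 f \<chi> +
      ap2 (\<lambda>u v. ap2 (\<lambda>x y. ap2 (\<lambda>p q. f (S x * (u * p)) (v * y * q)) R) \<chi>) (inv2 R) = 0"
    using ap2_chi_comult(1)[OF g] by (simp add: antipode_one)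
  thus ?thesis
    by (simp add: ap2_swap[of _ "inv2 R" \<chi>] eq_neg_iff_add_eq_0 mult.assoc)
qed

lemma ap2_chi_antipode:
  assumes f: "form2 f"
  shows "ap2 (\<lambda>x y. f (S x) (S y)) \<chi> =
    - ap2 (\<lambda>p q. ap2 (\<lambda>x y. ap2 (\<lambda>u v. f (p * S x * u) (q * v * y)) (inv2 R)) \<chi>) R"
proof -
  note [multilin] = form2_comp[OF f]
  \<comment> \<open>Here \<open>S\<close> reverses the products in the conjugated term, so that
    \<open>R\<close> moves to the front of the expression.\<close>
  have g: "form3 (\<lambda>x y z. f (S x) (S y * z))" by (intro multilin)
  have "ap2 (\<lambda>u v. f (S x) (S u * v)) (\<Delta> y) = \<epsilon> y * f (S x) 1" for x y
    by (rule ap2_antipode(1)) (intro multilin)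
  moreover have "ap2 (\<lambda>x y. \<epsilon> y * f (S x) 1) \<chi> = 0"
    by (rule ap2_chi_counit(2)) (intro multilin)
  ultimately have "0 = ap2 (\<lambda>x y. f (S x) (S y)) \<chi> + ap2 (\<lambda>u v. ap2 (\<lambda>x y. ap2 (\<lambda>p q.
      f (S p * (S x * S u)) (S q * (S v * y))) R) \<chi>) (inv2 R)"
    using ap2_chi_comult(2)[OF g] by (simp add: antipode_mult mult.assoc)
  \<comment> \<open>Invariance of \<open>R\<close> under S \<otimes> S, and in the next step that of
    its inverse, removes \<open>S\<close> from their legs.\<close>
  also have "ap2 (\<lambda>u v. ap2 (\<lambda>x y. ap2 (\<lambda>p q. f (S p * (S x * S u)) (S q * (S v * y))) R) \<chi>) (inv2 R) =
      ap2 (\<lambda>u v. ap2 (\<lambda>x y. ap2 (\<lambda>p q. f (p * (S x * S u)) (q * (S v * y))) R) \<chi>) (inv2 R)"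
  proof -
    have "form2 (\<lambda>p q. f (p * (S x * S u)) (q * (S v * y)))" for x y u v by (intro multilin)
    from ap2_antipode_R(1)[OF this] show ?thesis by simp
  qed
  also have "\<dots> = ap2 (\<lambda>u v. ap2 (\<lambda>x y. ap2 (\<lambda>p q. f (p * (S x * u)) (q * (v * y))) R) \<chi>) (inv2 R)"
  proof -
    have "form2 (\<lambda>u v. ap2 (\<lambda>x y. ap2 (\<lambda>p q. f (p * (S x * u)) (q * (v * y))) R) \<chi>)"
      by (intro multilin)
    from ap2_antipode_R(2)[OF this] show ?thesis .
  qed
  also have "\<dots> = ap2 (\<lambda>p q. ap2 (\<lambda>x y. ap2 (\<lambda>u v. f (p * S x * u) (q * v * y)) (inv2 R)) \<chi>) R"
    by (simp add: ap2_swap[of _ "inv2 R" \<chi>] ap2_swap[of _ "inv2 R" R] ap2_swap[of _ \<chi> R] mult.assoc)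
  finally show ?thesis
    by (simp add: eq_neg_iff_add_eq_0)
qed

text \<open>With \<open>M\<close> as above, conjugation turns \<open>\<chi> = - M R\<close> into
  \<open>- R M\<close>, which is the expression found for (S \<otimes> S)(\<chi>).\<close>

lemma map2_antipode_chi: "map2 S S \<chi> = R \<odot>\<^sub>2 \<chi> \<odot>\<^sub>2 inv2 R"
proof (rule tensor2_eqI)
  fix f :: "'a \<Rightarrow> 'a \<Rightarrow> 'k" assume f: "form2 f"
  note [multilin] = form2_comp[OF f]
  have [simp]: "form2 (\<lambda>x y. ap2 (\<lambda>u v. f (x * u) (y * v)) (inv2 R))"
    "form2 (\<lambda>x y. ap2 (\<lambda>u v. f (p * x * u) (q * y * v)) (inv2 R))" for p q
    by (intro multilin)+
  have cancel: "ap2 (\<lambda>r s. ap2 (\<lambda>t w. f (m * r * t) (n * s * w)) (inv2 R)) R = f m n" for m n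
  proof -
    have "form2 (\<lambda>a b. f (m * a) (n * b))" by (intro multilin)
    from ap2_R_inv2(1)[OF this] show ?thesis by (simp add: mult.assoc)
  qed
  have "ap2 f (R \<odot>\<^sub>2 \<chi> \<odot>\<^sub>2 inv2 R) =
      ap2 (\<lambda>p q. ap2 (\<lambda>x y. ap2 (\<lambda>u v. f (p * x * u) (q * y * v)) (inv2 R)) \<chi>) R"
    using f by (simp add: ap2_ops)
  also have "\<dots> = ap2 (\<lambda>p q. - ap2 (\<lambda>x y. ap2 (\<lambda>u v. ap2 (\<lambda>r s. ap2 (\<lambda>t w.
      f (p * (S x * u * r) * t) (q * (v * y * s) * w)) (inv2 R)) R) (inv2 R)) \<chi>) R"
  proof -
    have "form2 (\<lambda>x y. ap2 (\<lambda>u v. f (p * x * u) (q * y * v)) (inv2 R))" for p q by simp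
    from ap2_chi_antipode_left[OF this] show ?thesis by simp
  qed
  also have "\<dots> = ap2 (\<lambda>p q. - ap2 (\<lambda>x y. ap2 (\<lambda>u v. f (p * S x * u) (q * v * y)) (inv2 R)) \<chi>) R"
    by (simp add: cancel mult.assoc[symmetric])
  also have "\<dots> = ap2 (\<lambda>x y. f (S x) (S y)) \<chi>"
    by (simp add: ap2_chi_antipode[OF f] ap2_uminus)
  also have "\<dots> = ap2 f (map2 S S \<chi>)"
    by (simp add: ap2_ops f)
  finally show "ap2 f (map2 S S \<chi>) = ap2 f (R \<odot>\<^sub>2 \<chi> \<odot>\<^sub>2 inv2 R)" ..
qed simp_all

text \<open>The Cartier condition equates the flip of \<chi> with its conjugate by \<open>R\<close>,
  and \<open>map2_antipode_chi\<close> identifies that conjugate.\<close>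

lemma cartier_iff_flip_antipode:
  "R \<odot>\<^sub>2 \<chi> = flip \<chi> \<odot>\<^sub>2 R \<longleftrightarrow> \<chi> = flip (map2 S S \<chi>)"
proof -
  have "R \<odot>\<^sub>2 \<chi> = flip \<chi> \<odot>\<^sub>2 R \<longleftrightarrow> R \<odot>\<^sub>2 \<chi> \<odot>\<^sub>2 inv2 R = flip \<chi>"
  proof
    assume "R \<odot>\<^sub>2 \<chi> = flip \<chi> \<odot>\<^sub>2 R"
    thus "R \<odot>\<^sub>2 \<chi> \<odot>\<^sub>2 inv2 R = flip \<chi>"
      by (simp add: mult2_assoc R_inv2 mult2_one)
  next
    assume "R \<odot>\<^sub>2 \<chi> \<odot>\<^sub>2 inv2 R = flip \<chi>"
    hence "flip \<chi> \<odot>\<^sub>2 R = R \<odot>\<^sub>2 \<chi> \<odot>\<^sub>2 inv2 R \<odot>\<^sub>2 R" by simp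
    thus "R \<odot>\<^sub>2 \<chi> = flip \<chi> \<odot>\<^sub>2 R"
      by (simp add: mult2_assoc inv2_R mult2_one chi_mem)
  qed
  also have "\<dots> \<longleftrightarrow> \<chi> = flip (map2 S S \<chi>)"
    unfolding map2_antipode_chi[symmetric] using flip_flip chi_mem tensor2_mem(6) by metis
  finally show ?thesis .
qed

end

section \<open>Coboundaries \<open>b1\<close> and primitive elements\<close>

context hopf_algebra
begin

lemma ap2_b1: "form2 f \<Longrightarrow> ap2 f (b1 a) = f 1 a - ap2 f (\<Delta> a) + f a 1"
  by (simp add: b1_def ap2_ops)

text \<open>By \<open>comult_antipode\<close> the flip after S \<otimes> S sends
  \<open>\<Delta> a\<close> to \<open>\<Delta> (S a)\<close>, and it interchanges the roles of the
  two outer terms of \<open>b1\<close>.\<close>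

lemma b1_antipode: "b1 (S a) = flip (map2 S S (b1 a))"
proof (rule tensor2_eqI)
  fix f :: "'a \<Rightarrow> 'a \<Rightarrow> 'k" assume f: "form2 f"
  note [multilin] = form2_comp[OF f]
  have "form2 (\<lambda>x y. f y x)" "form2 (\<lambda>x y. f (S y) (S x))" by (intro multilin)+
  with f show "ap2 f (b1 (S a)) = ap2 f (flip (map2 S S (b1 a)))"
    by (simp add: ap2_b1 ap2_ops comult_antipode antipode_one)
qed (simp_all add: b1_def)

text \<open>The map \<open>b1\<close> is linear and its kernel consists of the primitive elements.
  Both facts are checked here on bilinear forms.\<close>

lemma primitive_diff_iff: "primitive (a - c) \<longleftrightarrow> b1 a = b1 c"
proof -
  have comult_diff: "ap2 f (\<Delta> (a - c)) = ap2 f (\<Delta> a) - ap2 f (\<Delta> c)" if "form2 f" for f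
    using that comult_add[of "a - c" c] by (simp add: ap2_ops)
  have diff: "f (a - c) x = f a x - f c x" "f x (a - c) = f x a - f x c" if "form2 f" for f x
  proof -
    have "f (a - c + c) x = f (a - c) x + f c x" "f x (a - c + c) = f x (a - c) + f x c"
      using that unfolding form2_def form1_def by blast+
    thus "f (a - c) x = f a x - f c x" "f x (a - c) = f x a - f x c" by simp_all
  qed
  have "primitive (a - c) \<longleftrightarrow>
      (\<forall>f. form2 f \<longrightarrow> ap2 f (\<Delta> (a - c)) = ap2 f ((a - c) \<otimes> 1 \<oplus>\<^sub>2 1 \<otimes> (a - c)))"
    unfolding primitive_def by (metis comult_mem tensor2_eqI tensor2_mem(2))
  also have "\<dots> \<longleftrightarrow> (\<forall>f. form2 f \<longrightarrow> ap2 f (b1 a) = ap2 f (b1 c))"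
    by (auto simp: ap2_ops ap2_b1 comult_diff diff algebra_simps)
  also have "\<dots> \<longleftrightarrow> b1 a = b1 c"
    by (metis b1_def tensor2_eqI tensor2_mem(2))
  finally show ?thesis .
qed

end

theorem corollary3p8:
  fixes scale :: "'k::field \<Rightarrow> 'a::ring_1 \<Rightarrow> 'a"
    and \<Delta> :: "'a \<Rightarrow> ('a, 'k) tensor2"
    and \<epsilon> :: "'a \<Rightarrow> 'k"
    and S :: "'a \<Rightarrow> 'a"
    and R \<chi> :: "('a, 'k) tensor2"
    and a :: 'a
  assumes "pre_cartier scale \<Delta> \<epsilon> S R \<chi>"
    and "\<chi> = hopf_algebra.b1 scale \<Delta> a"
  shows "cartier scale \<Delta> \<epsilon> S R \<chi> \<longleftrightarrow> hopf_algebra.primitive scale \<Delta> (a - S a)"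
proof -
  interpret pre_cartier scale \<Delta> \<epsilon> S R \<chi> by (rule assms(1))
  have "cartier scale \<Delta> \<epsilon> S R \<chi> \<longleftrightarrow> R \<odot>\<^sub>2 \<chi> = flip \<chi> \<odot>\<^sub>2 R"
    using assms(1) by (auto simp: cartier_def cartier_axioms_def)
  also have "\<dots> \<longleftrightarrow> b1 a = b1 (S a)"
    unfolding cartier_iff_flip_antipode b1_antipode by (simp add: assms(2))
  also have "\<dots> \<longleftrightarrow> primitive (a - S a)"
    by (rule primitive_diff_iff[symmetric])
  finally show ?thesis .
qed

end
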